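(* Let $f$ be a transcendental entire function. (i) Let $G$ be an invariant Baker domain of $f$ and let $f$ be injective on $G$. Then the set of all entire functions which are $H(G)$-universal for $C_f$ is a comeager set in $H(\mathbb{C})$. (ii) Let $G$ be a wandering domain of $f$, let $f^n$ be injective on $G$ for all $n\in\mathbb{N}$ and let $f^n|_G\to\infty$. Then the set of all entire functions which are $H(W)$-universal for $C_f$ for all $W\in\mathcal{U}_0(O^+(G))$ is a comeager set in $H(\mathbb{C})$. If, in addition, $G$ is simply connected, the set of all entire functions which are $H(O^+(G))$-universal for $C_f$ is a comeager set in $H(\mathbb{C})$.
   Context: $\mathbb{N}=\{1,2,\dots\}$; $f^n$ is the $n$-th iterate of $f$. For open $W\subset\mathbb{C}$, $H(W)$ is the Fréchet space of holomorphic functions on $W$ with the topology of locally uniform convergence. $\mathbb{C}_\infty=\mathbb{C}\cup\{\infty\}$ carries the chordal metric. The Fatou set $F_f$ is the set of all $z\in\mathbb{C}$ having a neighbourhood $W$ such that $\{f^n|_W:n\in\mathbb{N}\}$ is a normal family in $C(W,\mathbb{C}_\infty)$ (every sequence in it has a subsequence converging uniformly on compact subsets of $W$ to a function in $C(W,\mathbb{C}_\infty)$). For a component $G$ of $F_f$ let $G_0:=G$ and let $G_n$ be the component of $F_f$ with $f^n(G)\subset G_n$. $G$ is preperiodic if $G_p=G_m$ for some integers $p>m\geq0$; it is invariant if $f(G)\subset G$. An invariant Baker domain of $f$ is an invariant component $G$ of $F_f$ with $f^n|_G\to\infty$. A wandering domain of $f$ is a component of $F_f$ which is not preperiodic. $O^+(G):=\bigcup_{k\in\mathbb{N}}f^k(G)$.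 A hole of $M\subset\mathbb{C}$ is a component of $\mathbb{C}_\infty\setminus M$ not containing $\infty$; $\mathcal{U}_0(M)$ is the set of all non-empty subsets of $M$ which are open in $\mathbb{C}$ and have no holes. For an open set $W\subset F_f$, an entire function $g$ is called $H(W)$-universal for $C_f$ (the composition operator $g\mapsto g\circ f$) if $\{g\circ f^n|_W:n\in\mathbb{N}\}$ is dense in $H(W)$. A subset of a Baire space is comeager if it contains a dense $G_\delta$-set. *)

theory Defs
  imports "HOL-Complex_Analysis.Complex_Analysis"
begin

section \<open>The extended complex plane with the chordal metric\<close>

datatype extended_complex = Fin complex | Infty

fun stereo :: "extended_complex \<Rightarrow> complex \<times> real" where
  "stereo (Fin z) = ((2 / (1 + (norm z)\<^sup>2)) *\<^sub>R z, ((norm z)\<^sup>2 - 1) / ((norm z)\<^sup>2 + 1))"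
| "stereo Infty = (0, 1)"

lemma stereo_inj: "stereo p = stereo q \<Longrightarrow> p = q"
proof -
  have fin: "z = w" if "stereo (Fin z) = stereo (Fin w)" for z w
  proof -
    have pos: "(norm u)\<^sup>2 + 1 > 0" "1 + (norm u)\<^sup>2 > 0" for u :: complex
      by (simp_all add: add_nonneg_pos add_pos_nonneg)
    have *: "((norm u)\<^sup>2 - 1) / ((norm u)\<^sup>2 + 1) = 1 - 2 / (1 + (norm u)\<^sup>2)" for u :: complex
      using pos[of u] by (simp add: field_simps)
    have "2 / (1 + (norm z)\<^sup>2) = 2 / (1 + (norm w)\<^sup>2)"
      using that *[of z] *[of w] by simp
    moreover have "2 / (1 + (norm z)\<^sup>2) \<noteq> 0"
      using pos[of z] by simp
    ultimately show ?thesis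
      using that by (metis stereo.simps(1) fst_conv scaleR_cancel_left)
  qed
  have inf: "stereo (Fin z) \<noteq> stereo Infty" for z
  proof
    assume "stereo (Fin z) = stereo Infty"
    then have e: "((norm z)\<^sup>2 - 1) / ((norm z)\<^sup>2 + 1) = 1" by simp
    have "(norm z)\<^sup>2 + 1 \<noteq> 0" using zero_le_power2[of "norm z"] by linarith
    with e show False by (simp add: field_simps)
  qed
  show "stereo p = stereo q \<Longrightarrow> p = q"
    using fin inf by (cases p; cases q) (auto simp del: stereo.simps)
qed

text \<open>The chordal distance is the Euclidean distance in \<open>\<complex> \<times> \<real>\<close> of the stereographic images.\<close>

instantiation extended_complex :: metric_space
begin

definition dist_extended_complex :: "extended_complex \<Rightarrow> extended_complex \<Rightarrow> real" where
  "dist_extended_complex p q = dist (stereo p) (stereo q)"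

definition uniformity_extended_complex :: "(extended_complex \<times> extended_complex) filter" where
  "uniformity_extended_complex = (INF e\<in>{0 <..}. principal {(p, q). dist p q < e})"

definition open_extended_complex :: "extended_complex set \<Rightarrow> bool" where
  "open_extended_complex U =
     (\<forall>p\<in>U. eventually (\<lambda>(p', q). p' = p \<longrightarrow> q \<in> U) uniformity)"

instance
proof
  fix p q r :: extended_complex
  show "dist p q = 0 \<longleftrightarrow> p = q"
    by (auto simp: dist_extended_complex_def dest: stereo_inj)
  show "dist p q \<le> dist p r + dist q r"
    unfolding dist_extended_complex_def by (rule dist_triangle2)
qed (rule uniformity_extended_complex_def open_extended_complex_def)+

end

lemma chordal_Fin_Infty: "dist (Fin z) Infty = 2 / sqrt (1 + (norm z)\<^sup>2)"
proof -
  define a where "a = (norm z)\<^sup>2"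
  have a: "a \<ge> 0" by (simp add: a_def)
  have "(2 / (1 + a) * norm z)\<^sup>2 + ((a - 1) / (a + 1) - 1)\<^sup>2
          = (4 * a + 4) / (1 + a)\<^sup>2"
  proof -
    have "(a - 1) / (a + 1) - 1 = - 2 / (1 + a)" using a by (simp add: field_simps)
    then show ?thesis
      by (simp add: power_mult_distrib power_divide a_def add_divide_distrib)
  qed
  also have "\<dots> = 4 * (1 + a) / ((1 + a) * (1 + a))" by (simp add: power2_eq_square algebra_simps)
  also have "\<dots> = 4 / (1 + a)"
    using a by (subst mult_divide_mult_cancel_right) auto
  finally have eq: "(2 / (1 + a) * norm z)\<^sup>2 + ((a - 1) / (a + 1) - 1)\<^sup>2 = 4 / (1 + a)" .
  have "dist (Fin z) Infty = sqrt ((2 / (1 + a) * norm z)\<^sup>2 + ((a - 1) / (a + 1) - 1)\<^sup>2)"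
    using a by (simp add: dist_extended_complex_def dist_Pair_Pair dist_real_def a_def)
  then show ?thesis unfolding eq by (simp add: real_sqrt_divide a_def)
qed

lemma chordal_Fin_Fin:
  "dist (Fin z) (Fin w)
     = 2 * norm (z - w) / (sqrt (1 + (norm z)\<^sup>2) * sqrt (1 + (norm w)\<^sup>2))"
proof -
  define a where "a = (norm z)\<^sup>2"
  define b where "b = (norm w)\<^sup>2"
  define c where "c = inner z w"
  have nn: "a \<ge> 0" "b \<ge> 0" by (simp_all add: a_def b_def)
  have az: "inner z z = a" "inner w w = b" "inner w z = c"
    by (simp_all add: a_def b_def c_def power2_norm_eq_inner inner_commute)
  have d: "(norm (z - w))\<^sup>2 = a + b - 2 * c"
    by (simp add: power2_norm_eq_inner inner_diff_left inner_diff_right az c_def[symmetric])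
  define s where "s = 2 / (1 + a)"
  define t where "t = 2 / (1 + b)"
  have sa: "s * a = 2 - s" and tb: "t * b = 2 - t"
    using nn by (simp_all add: s_def t_def field_simps)
  have e1: "(norm (s *\<^sub>R z - t *\<^sub>R w))\<^sup>2 = s * (s * a) + t * (t * b) - 2 * s * t * c"
    by (simp add: power2_norm_eq_inner inner_diff_left inner_diff_right az c_def[symmetric] algebra_simps)
  have e2: "(a - 1) / (a + 1) - (b - 1) / (b + 1) = t - s"
    using nn by (simp add: s_def t_def field_simps)
  have ab: "s * t * (a + b) = t * (2 - s) + s * (2 - t)"
    unfolding sa[symmetric] tb[symmetric] by (simp add: algebra_simps)
  have "(norm (s *\<^sub>R z - t *\<^sub>R w))\<^sup>2 + ((a - 1) / (a + 1) - (b - 1) / (b + 1))\<^sup>2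
          = s * t * (a + b - 2 * c)"
    unfolding e1 e2 sa tb using ab by (simp add: power2_eq_square algebra_simps)
  also have "\<dots> = (2 * norm (z - w))\<^sup>2 / ((1 + a) * (1 + b))"
    by (simp add: s_def t_def power_mult_distrib d)
  finally have eq: "(norm (s *\<^sub>R z - t *\<^sub>R w))\<^sup>2 + ((a - 1) / (a + 1) - (b - 1) / (b + 1))\<^sup>2
          = (2 * norm (z - w))\<^sup>2 / ((1 + a) * (1 + b))" .
  have "dist (Fin z) (Fin w)
      = sqrt ((norm (s *\<^sub>R z - t *\<^sub>R w))\<^sup>2 + ((a - 1) / (a + 1) - (b - 1) / (b + 1))\<^sup>2)"
    by (simp add: dist_extended_complex_def dist_norm norm_Pair a_def b_def s_def t_def)
  then show ?thesis
    unfolding eq by (simp add: real_sqrt_divide real_sqrt_mult a_def b_def)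
qed


section \<open>Fatou set\<close>

definition transcendental_entire :: "(complex \<Rightarrow> complex) \<Rightarrow> bool" where
  "transcendental_entire f \<longleftrightarrow>
     f holomorphic_on UNIV \<and> \<not> (\<exists>p :: complex poly. \<forall>z. f z = poly p z)"

definition converges_locally_uniformly ::
  "complex set \<Rightarrow> (nat \<Rightarrow> complex \<Rightarrow> extended_complex) \<Rightarrow> (complex \<Rightarrow> extended_complex) \<Rightarrow> bool"
where
  "converges_locally_uniformly W s h \<longleftrightarrow>
     (\<forall>K. compact K \<and> K \<subseteq> W \<longrightarrow> uniform_limit K s h sequentially)"

definition normal_family :: "complex set \<Rightarrow> (complex \<Rightarrow> extended_complex) set \<Rightarrow> bool" where
  "normal_family W \<F> \<longleftrightarrow>
     (\<forall>s :: nat \<Rightarrow> complex \<Rightarrow> extended_complex. range s \<subseteq> \<F> \<longrightarrow>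
       (\<exists>(r :: nat \<Rightarrow> nat) h. strict_mono r \<and> continuous_on W h \<and>
          converges_locally_uniformly W (s \<circ> r) h))"

definition fatou_set :: "(complex \<Rightarrow> complex) \<Rightarrow> complex set" where
  "fatou_set f =
     {z. \<exists>W. open W \<and> z \<in> W \<and> normal_family W {Fin \<circ> (f ^^ n) |n. n \<ge> 1}}"

definition fatou_component :: "(complex \<Rightarrow> complex) \<Rightarrow> complex set \<Rightarrow> bool" where
  "fatou_component f G \<longleftrightarrow> G \<in> components (fatou_set f)"

text \<open>For a component \<open>G\<close> this is \<open>G\<^sub>n\<close>; in particular \<open>G\<^sub>0 = G\<close>.\<close>

definition image_component :: "(complex \<Rightarrow> complex) \<Rightarrow> complex set \<Rightarrow> nat \<Rightarrow> complex set" where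
  "image_component f G n = (THE C. fatou_component f C \<and> (f ^^ n) ` G \<subseteq> C)"

lemma image_component_0:
  assumes G: "fatou_component f G"
  shows "image_component f G 0 = G"
  unfolding image_component_def
proof (rule the_equality)
  show "fatou_component f G \<and> (f ^^ 0) ` G \<subseteq> G" using G by simp
next
  fix C
  assume C: "fatou_component f C \<and> (f ^^ 0) ` G \<subseteq> C"
  then have "G \<subseteq> C" by simp
  moreover have "G \<noteq> {}"
    using G unfolding fatou_component_def by (rule in_components_nonempty)
  ultimately have "C \<inter> G \<noteq> {}" by blast
  moreover have "C \<inter> G = {} \<longleftrightarrow> C \<noteq> G"
    using C G unfolding fatou_component_def by (intro components_nonoverlap) auto
  ultimately show "C = G" by blast
qed

definition preperiodic_component :: "(complex \<Rightarrow> complex) \<Rightarrow> complex set \<Rightarrow> bool" where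
  "preperiodic_component f G \<longleftrightarrow>
     (\<exists>p m. p > m \<and> image_component f G p = image_component f G m)"

definition tends_to_infinity_on :: "(complex \<Rightarrow> complex) \<Rightarrow> complex set \<Rightarrow> bool" where
  "tends_to_infinity_on f G \<longleftrightarrow>
     converges_locally_uniformly G (\<lambda>n. Fin \<circ> (f ^^ n)) (\<lambda>_. Infty)"

definition invariant_baker_domain :: "(complex \<Rightarrow> complex) \<Rightarrow> complex set \<Rightarrow> bool" where
  "invariant_baker_domain f G \<longleftrightarrow>
     fatou_component f G \<and> f ` G \<subseteq> G \<and> tends_to_infinity_on f G"

definition wandering_domain :: "(complex \<Rightarrow> complex) \<Rightarrow> complex set \<Rightarrow> bool" where
  "wandering_domain f G \<longleftrightarrow> fatou_component f G \<and> \<not> preperiodic_component f G"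

definition forward_orbit :: "(complex \<Rightarrow> complex) \<Rightarrow> complex set \<Rightarrow> complex set" where
  "forward_orbit f G = (\<Union>k\<in>{1..}. (f ^^ k) ` G)"

definition holes :: "complex set \<Rightarrow> extended_complex set set" where
  "holes M = {C \<in> components (- (Fin ` M)). Infty \<notin> C}"

definition open_subsets_without_holes :: "complex set \<Rightarrow> complex set set" where
  "open_subsets_without_holes M = {W. W \<noteq> {} \<and> W \<subseteq> M \<and> open W \<and> holes W = {}}"


section \<open>Spaces of holomorphic functions and universality\<close>

text \<open>
  Holomorphic functions on \<open>W\<close> are represented by their extensional representatives, which take
  the value \<^term>\<open>undefined\<close> outside \<open>W\<close>, so that functions agreeing on \<open>W\<close> are identified.
  The topology is that of uniform convergence on compact subsets of \<open>W\<close>.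
\<close>

definition holo_functions :: "complex set \<Rightarrow> (complex \<Rightarrow> complex) set" where
  "holo_functions W = {h \<in> extensional W. h holomorphic_on W}"

definition holo_space :: "complex set \<Rightarrow> (complex \<Rightarrow> complex) topology" where
  "holo_space W = topology (\<lambda>U. U \<subseteq> holo_functions W \<and>
     (\<forall>g\<in>U. \<exists>K e. compact K \<and> K \<subseteq> W \<and> e > 0 \<and>
        {h \<in> holo_functions W. \<forall>z\<in>K. dist (h z) (g z) < e} \<subseteq> U))"

lemma openin_holo_space:
  "openin (holo_space W) U \<longleftrightarrow> U \<subseteq> holo_functions W \<and>
     (\<forall>g\<in>U. \<exists>K e. compact K \<and> K \<subseteq> W \<and> e > 0 \<and>
        {h \<in> holo_functions W. \<forall>z\<in>K. dist (h z) (g z) < e} \<subseteq> U)"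
proof -
  define B where "B g K e = {h \<in> holo_functions W. \<forall>z\<in>K. dist (h z) (g z) < e}"
    for g :: "complex \<Rightarrow> complex" and K and e :: real
  define N where "N U g \<longleftrightarrow> (\<exists>K e. compact K \<and> K \<subseteq> W \<and> e > 0 \<and> B g K e \<subseteq> U)" for U g
  have int: "N (S \<inter> T) g" if "N S g" "N T g" for S T g
  proof -
    obtain K e where K: "compact K" "K \<subseteq> W" "e > 0" "B g K e \<subseteq> S"
      using \<open>N S g\<close> unfolding N_def by metis
    obtain L d where L: "compact L" "L \<subseteq> W" "d > 0" "B g L d \<subseteq> T"
      using \<open>N T g\<close> unfolding N_def by metis
    have "B g (K \<union> L) (min e d) \<subseteq> B g K e \<inter> B g L d"
      unfolding B_def by auto
    then have "B g (K \<union> L) (min e d) \<subseteq> S \<inter> T"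
      using K(4) L(4) by (meson Int_mono subset_trans)
    moreover have "compact (K \<union> L)" "K \<union> L \<subseteq> W" "min e d > 0"
      using K L by (simp_all add: compact_Un)
    ultimately show ?thesis unfolding N_def by (intro exI conjI)
  qed
  have mono: "N T g" if "N S g" "S \<subseteq> T" for S T g
    using that unfolding N_def by (meson subset_trans)
  have "istopology (\<lambda>U. U \<subseteq> holo_functions W \<and> (\<forall>g\<in>U. N U g))"
    unfolding istopology_def
  proof (intro conjI allI impI ballI)
    fix S T g
    assume "S \<subseteq> holo_functions W \<and> (\<forall>g\<in>S. N S g)" "T \<subseteq> holo_functions W \<and> (\<forall>g\<in>T. N T g)"
      "g \<in> S \<inter> T"
    then show "N (S \<inter> T) g" by (metis IntD1 IntD2 int)
  next
    fix \<K> g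
    assume \<K>: "\<forall>S\<in>\<K>. S \<subseteq> holo_functions W \<and> (\<forall>g\<in>S. N S g)" and "g \<in> \<Union>\<K>"
    then obtain S where "S \<in> \<K>" "g \<in> S" by blast
    then have "N S g" "S \<subseteq> \<Union>\<K>" using \<K> by (simp_all add: Union_upper)
    then show "N (\<Union>\<K>) g" by (rule mono)
  qed (simp_all add: Union_least le_infI1)
  then show ?thesis
    unfolding holo_space_def N_def B_def by (rule topology_inverse'[THEN fun_cong])
qed

lemma topspace_holo_space: "topspace (holo_space W) = holo_functions W"
proof
  show "topspace (holo_space W) \<subseteq> holo_functions W"
    using openin_topspace[of "holo_space W"] unfolding openin_holo_space by (rule conjunct1)
  have "openin (holo_space W) (holo_functions W)"
    unfolding openin_holo_space
    by (intro conjI ballI subset_refl exI[of _ "{}"] exI[of _ 1]) auto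
  then show "holo_functions W \<subseteq> topspace (holo_space W)"
    by (rule openin_subset)
qed

definition dense_in :: "'a topology \<Rightarrow> 'a set \<Rightarrow> bool" where
  "dense_in X S \<longleftrightarrow> S \<subseteq> topspace X \<and> X closure_of S = topspace X"

definition comeager_in :: "'a topology \<Rightarrow> 'a set \<Rightarrow> bool" where
  "comeager_in X A \<longleftrightarrow>
     A \<subseteq> topspace X \<and> (\<exists>S. gdelta_in X S \<and> dense_in X S \<and> S \<subseteq> A)"

definition universal_for :: "(complex \<Rightarrow> complex) \<Rightarrow> complex set \<Rightarrow> (complex \<Rightarrow> complex) \<Rightarrow> bool" where
  "universal_for f W g \<longleftrightarrow>
     g holomorphic_on UNIV \<and>
     dense_in (holo_space W) {restrict (g \<circ> (f ^^ n)) W |n. n \<ge> 1}"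

end

theory Submission
  imports Defs
begin

text \<open>
  Universality of an entire function \<open>g\<close> on an open set \<open>W\<close> means that every function holomorphic
  on \<open>W\<close> is approximated by some \<open>g \<circ> f\<^sup>n\<close> on every compact subset of \<open>W\<close>.  Call a compact set
  nonseparating if its complement is connected.  By Runge's theorem holomorphic functions near
  such a set are limits of polynomials.  So if every compact subset of \<open>W\<close> lies in a nonseparating
  compact subset of \<open>W\<close>, then only polynomials and nonseparating sets have to be dealt with.

  Let \<open>\<Omega>\<close> be open, let all iterates of \<open>f\<close> be injective on \<open>\<Omega>\<close> and tend to infinity there, and
  let \<open>K \<subseteq> \<Omega>\<close> be compact and nonseparating.  For large \<open>n\<close> the set \<open>f\<^sup>n(K)\<close> is disjoint from a
  given disc; it is nonseparating because it is homeomorphic to \<open>K\<close>, and by Janiszewski's theorem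
  its union with the disc is nonseparating as well.  Runge's theorem, applied to the function that
  is a given entire function on the disc and \<open>q \<circ> f\<^sup>-\<^sup>n\<close> near \<open>f\<^sup>n(K)\<close>, yields a polynomial close to the
  former on the disc and whose composition with \<open>f\<^sup>n\<close> is close to \<open>q\<close> on \<open>K\<close>
  (\<open>dense_orbit_approximants\<close>).  Hence the entire functions that approximate \<open>q\<close> on \<open>K\<close> up to a
  given error along the orbit form a dense open set.  Countably many triples of \<open>K\<close>, \<open>q\<close> and error
  are enough (\<open>countable_cofinal_nonseparating\<close>, \<open>rational_poly_approx\<close>), and Baire's argument
  shows that the set \<open>poly_universal f \<Omega>\<close> of the entire functions that work for all \<open>K\<close> and \<open>q\<close> at once
  is comeager.  It depends on \<open>\<Omega>\<close> only, so one comeager set serves all \<open>W \<subseteq> \<Omega>\<close> together.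

  It remains to see that a compact \<open>K \<subseteq> W\<close> can be enlarged to a nonseparating compact subset of \<open>W\<close>,
  for which it suffices that the bounded components of the complement of \<open>K\<close> lie in \<open>W\<close>.
  If \<open>W\<close> has no holes, this is a connectedness argument on the sphere.  If \<open>G\<close> is a simply connected
  wandering domain, then the sets \<open>f\<^sup>k(G)\<close> are simply connected and pairwise disjoint, and \<open>K\<close> meets
  finitely many of them.  For an invariant Baker domain \<open>G\<close> it is Baker's argument
  (\<open>invariant_escaping_component_fills\<close>).  Let \<open>V\<close> be a bounded component of the complement of
  \<open>K \<subseteq> G\<close>.  If \<open>f\<^sup>n\<close> has no zeros in \<open>V\<close> for all large \<open>n\<close>, then the minimum modulus principle shows
  that the iterates tend to infinity on \<open>V\<close>, so \<open>V\<close> lies in the Fatou set and hence in \<open>G\<close>.  Otherwise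
  \<open>f\<^sup>n(V)\<close> covers large discs for infinitely many \<open>n\<close>, and Harnack's inequality for \<open>ln \<bar>f\<^sup>n\<bar>\<close>, which is
  positive and harmonic near \<open>K \<union> f(K) \<subseteq> G\<close> for large \<open>n\<close>, bounds \<open>f\<close> on these discs by a fixed power
  of the radius.
  Then \<open>f\<close> is a polynomial, which is excluded.
\<close>

section \<open>Uniform approximation by polynomials\<close>

definition poly_approximable :: "complex set \<Rightarrow> (complex \<Rightarrow> complex) \<Rightarrow> bool" where
  "poly_approximable K \<phi> \<longleftrightarrow> (\<forall>e>0. \<exists>p. \<forall>z\<in>K. cmod (\<phi> z - poly p z) < e)"

lemma poly_approximableD:
  assumes "poly_approximable K \<phi>" "e > 0"
  obtains p where "\<And>z. z \<in> K \<Longrightarrow> cmod (\<phi> z - poly p z) < e"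
  using assms unfolding poly_approximable_def by blast

lemma poly_approximable_poly [intro]: "poly_approximable K (\<lambda>z. poly p z)"
  unfolding poly_approximable_def by (intro allI impI exI[of _ p]) auto

lemma poly_approximable_const [intro]: "poly_approximable K (\<lambda>z. c)"
  using poly_approximable_poly[of K "[:c:]"] by simp

lemma poly_approximable_cong:
  assumes "\<And>z. z \<in> K \<Longrightarrow> \<phi> z = \<psi> z"
  shows "poly_approximable K \<phi> \<longleftrightarrow> poly_approximable K \<psi>"
  using assms unfolding poly_approximable_def by simp

lemma poly_approximable_uniform_limit:
  assumes "\<And>e. e > 0 \<Longrightarrow> \<exists>\<psi>. poly_approximable K \<psi> \<and> (\<forall>z\<in>K. cmod (\<phi> z - \<psi> z) < e)"
  shows "poly_approximable K \<phi>"
  unfolding poly_approximable_def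
proof (intro allI impI)
  fix e :: real assume e: "e > 0"
  then obtain \<psi> where \<psi>: "poly_approximable K \<psi>" "\<And>z. z \<in> K \<Longrightarrow> cmod (\<phi> z - \<psi> z) < e/2"
    using assms[of "e/2"] by auto
  obtain p where p: "\<And>z. z \<in> K \<Longrightarrow> cmod (\<psi> z - poly p z) < e/2"
    using poly_approximableD[OF \<psi>(1), of "e/2"] e by auto
  show "\<exists>p. \<forall>z\<in>K. cmod (\<phi> z - poly p z) < e"
  proof (intro exI ballI)
    fix z assume "z \<in> K"
    then show "cmod (\<phi> z - poly p z) < e"
      using \<psi>(2)[of z] p[of z] norm_triangle_ineq[of "\<phi> z - \<psi> z" "\<psi> z - poly p z"] by simp
  qed
qed

lemma poly_approximable_add:
  assumes "poly_approximable K \<phi>" "poly_approximable K \<psi>"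
  shows "poly_approximable K (\<lambda>z. \<phi> z + \<psi> z)"
  unfolding poly_approximable_def
proof (intro allI impI)
  fix e :: real assume e: "e > 0"
  obtain p where p: "\<And>z. z \<in> K \<Longrightarrow> cmod (\<phi> z - poly p z) < e/2"
    using poly_approximableD[OF assms(1), of "e/2"] e by auto
  obtain q where q: "\<And>z. z \<in> K \<Longrightarrow> cmod (\<psi> z - poly q z) < e/2"
    using poly_approximableD[OF assms(2), of "e/2"] e by auto
  show "\<exists>p. \<forall>z\<in>K. cmod (\<phi> z + \<psi> z - poly p z) < e"
  proof (intro exI ballI)
    fix z assume "z \<in> K"
    then show "cmod (\<phi> z + \<psi> z - poly (p + q) z) < e"
      using p[of z] q[of z] norm_triangle_ineq[of "\<phi> z - poly p z" "\<psi> z - poly q z"]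
      by (simp add: algebra_simps)
  qed
qed

lemma poly_approximable_bounded:
  assumes "compact K" "poly_approximable K \<phi>"
  obtains M where "M > 0" "\<And>z. z \<in> K \<Longrightarrow> cmod (\<phi> z) \<le> M"
proof -
  obtain p where p: "\<And>z. z \<in> K \<Longrightarrow> cmod (\<phi> z - poly p z) < 1"
    using poly_approximableD[OF assms(2), of 1] by auto
  have "compact (poly p ` K)"
    using assms(1) by (intro compact_continuous_image continuous_intros)
  then obtain B where B: "B > 0" "\<And>z. z \<in> K \<Longrightarrow> cmod (poly p z) \<le> B"
    by (metis compact_imp_bounded bounded_pos image_eqI)
  show ?thesis
  proof
    show "B + 1 > 0" using B by simp
    fix z assume "z \<in> K"
    then show "cmod (\<phi> z) \<le> B + 1"
      using p[of z] B(2)[of z] norm_triangle_ineq[of "\<phi> z - poly p z" "poly p z"] by simp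
  qed
qed

lemma poly_approximable_mult:
  assumes K: "compact K" and "poly_approximable K \<phi>" "poly_approximable K \<psi>"
  shows "poly_approximable K (\<lambda>z. \<phi> z * \<psi> z)"
  unfolding poly_approximable_def
proof (intro allI impI)
  fix e :: real assume e: "e > 0"
  obtain M where M: "M > 0" "\<And>z. z \<in> K \<Longrightarrow> cmod (\<psi> z) \<le> M"
    using poly_approximable_bounded[OF K assms(3)] by auto
  obtain p where p: "\<And>z. z \<in> K \<Longrightarrow> cmod (\<phi> z - poly p z) < e / (2 * M)"
    using poly_approximableD[OF assms(2), of "e / (2 * M)"] e M by auto
  obtain N where N: "N > 0" "\<And>z. z \<in> K \<Longrightarrow> cmod (poly p z) \<le> N"
    using poly_approximable_bounded[OF K poly_approximable_poly] by auto
  obtain q where q: "\<And>z. z \<in> K \<Longrightarrow> cmod (\<psi> z - poly q z) < e / (2 * N)"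
    using poly_approximableD[OF assms(3), of "e / (2 * N)"] e N by auto
  show "\<exists>p. \<forall>z\<in>K. cmod (\<phi> z * \<psi> z - poly p z) < e"
  proof (intro exI ballI)
    fix z assume z: "z \<in> K"
    have "cmod (\<phi> z * \<psi> z - poly (p * q) z)
        = cmod ((\<phi> z - poly p z) * \<psi> z + poly p z * (\<psi> z - poly q z))"
      by (simp add: algebra_simps)
    also have "\<dots> \<le> cmod (\<phi> z - poly p z) * cmod (\<psi> z) + cmod (poly p z) * cmod (\<psi> z - poly q z)"
      by (metis norm_mult norm_triangle_ineq)
    also have "\<dots> \<le> cmod (\<phi> z - poly p z) * M + N * cmod (\<psi> z - poly q z)"
      using M(2)[OF z] N(2)[OF z] by (intro add_mono mult_left_mono mult_right_mono) auto
    also have "\<dots> < (e / (2 * M)) * M + N * (e / (2 * N))"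
      using p[OF z] q[OF z] M N by (intro add_strict_mono mult_strict_left_mono mult_strict_right_mono) auto
    also have "\<dots> = e" using M N by simp
    finally show "cmod (\<phi> z * \<psi> z - poly (p * q) z) < e" .
  qed
qed

lemma poly_approximable_cmult:
  "poly_approximable K \<phi> \<Longrightarrow> compact K \<Longrightarrow> poly_approximable K (\<lambda>z. c * \<phi> z)"
  by (rule poly_approximable_mult) auto

lemma poly_approximable_sum:
  assumes "\<And>i. i \<in> I \<Longrightarrow> poly_approximable K (\<phi> i)"
  shows "poly_approximable K (\<lambda>z. \<Sum>i\<in>I. \<phi> i z)"
  using assms by (induction I rule: infinite_finite_induct) (auto intro: poly_approximable_add)

lemma poly_approximable_power:
  "compact K \<Longrightarrow> poly_approximable K \<phi> \<Longrightarrow> poly_approximable K (\<lambda>z. \<phi> z ^ n)"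
  by (induction n) (auto intro: poly_approximable_mult)

text \<open>
  The partial sums of the geometric series converge uniformly.  This is the only series needed to
  move poles, both near a given pole and near infinity.
\<close>

lemma poly_approximable_inverse_one_minus:
  assumes K: "compact K" and \<phi>: "poly_approximable K \<phi>" and le: "\<And>z. z \<in> K \<Longrightarrow> cmod (\<phi> z) \<le> 1/2"
  shows "poly_approximable K (\<lambda>z. 1 / (1 - \<phi> z))"
proof (rule poly_approximable_uniform_limit)
  fix e :: real assume e: "e > 0"
  obtain n where n: "(1/2) ^ n < e / 2"
    using real_arch_pow_inv[of "e/2" "1/2"] e by auto
  show "\<exists>\<psi>. poly_approximable K \<psi> \<and> (\<forall>z\<in>K. cmod (1 / (1 - \<phi> z) - \<psi> z) < e)"
  proof (intro exI conjI ballI)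
    show "poly_approximable K (\<lambda>z. \<Sum>i<n. \<phi> z ^ i)"
      by (intro poly_approximable_sum poly_approximable_power K \<phi>)
    fix z assume z: "z \<in> K"
    have ne: "1 - \<phi> z \<noteq> 0" using le[OF z] by auto
    have b: "cmod (1 - \<phi> z) \<ge> 1/2"
      using le[OF z] norm_triangle_ineq2[of 1 "\<phi> z"] by simp
    have "1 / (1 - \<phi> z) - (\<Sum>i<n. \<phi> z ^ i) = \<phi> z ^ n / (1 - \<phi> z)"
      using ne by (subst sum_gp_strict) (auto simp: diff_divide_distrib[symmetric])
    then have "cmod (1 / (1 - \<phi> z) - (\<Sum>i<n. \<phi> z ^ i)) = cmod (\<phi> z) ^ n / cmod (1 - \<phi> z)"
      by (simp add: norm_divide norm_power)
    also have "\<dots> \<le> (1/2) ^ n / (1/2)"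
      using b le[OF z] by (intro frac_le power_mono) auto
    also have "\<dots> < e" using n by simp
    finally show "cmod (1 / (1 - \<phi> z) - (\<Sum>i<n. \<phi> z ^ i)) < e" .
  qed
qed

text \<open>
  The quotient \<open>1/(z - b)\<close> equals \<open>1/(z - a)\<close> times \<open>1/(1 - u)\<close> with \<open>u = (b - a)/(z - a)\<close>, and \<open>u\<close> is
  small when \<open>b\<close> is much closer to \<open>a\<close> than \<open>K\<close> is.
\<close>

lemma poly_approximable_move_pole:
  assumes K: "compact K" and a: "poly_approximable K (\<lambda>z. 1 / (z - a))"
    and near: "\<And>z. z \<in> K \<Longrightarrow> 2 * cmod (b - a) \<le> cmod (z - a)" and "a \<notin> K"
  shows "poly_approximable K (\<lambda>z. 1 / (z - b))"
proof -
  have "poly_approximable K (\<lambda>z. 1 / (z - a) * (1 / (1 - (b - a) * (1 / (z - a)))))"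
  proof (intro poly_approximable_mult poly_approximable_inverse_one_minus K a poly_approximable_const)
    fix z assume "z \<in> K"
    with near[of z] \<open>a \<notin> K\<close> show "cmod ((b - a) * (1 / (z - a))) \<le> 1/2"
      by (cases "z = a") (auto simp: norm_divide divide_simps)
  qed
  also have "?this \<longleftrightarrow> ?thesis"
  proof (rule poly_approximable_cong)
    fix z assume "z \<in> K"
    then have "z - a \<noteq> 0" using \<open>a \<notin> K\<close> by auto
    then have "(z - a) * (1 - (b - a) * (1 / (z - a))) = z - b" by (simp add: field_simps)
    then show "1 / (z - a) * (1 / (1 - (b - a) * (1 / (z - a)))) = 1 / (z - b)"
      by (simp only: times_divide_times_eq mult_1_left)
  qed
  finally show ?thesis .
qed

text \<open>
  Pole pushing: a pole far away from \<open>K\<close> is harmless by the geometric series in \<open>z/a\<close>, and the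
  connected complement of \<open>K\<close> allows to move it to any other place off \<open>K\<close>.
\<close>

lemma poly_approximable_inverse:
  assumes K: "compact K" "connected (- K)" and b: "b \<notin> K"
  shows "poly_approximable K (\<lambda>z. 1 / (z - b))"
proof -
  obtain B where B: "B > 0" "\<And>z. z \<in> K \<Longrightarrow> cmod z \<le> B"
    by (metis K(1) compact_imp_bounded bounded_pos)
  define a :: complex where "a = of_real (2 * B)"
  have na: "cmod a = 2 * B" "a \<noteq> 0" using B by (auto simp: a_def)
  have aK: "a \<in> - K" using B(1) B(2)[of a] na(1) by auto
  have "poly_approximable K (\<lambda>z. (-1/a) * (1 / (1 - poly [:0, 1/a:] z)))"
  proof (intro poly_approximable_mult poly_approximable_inverse_one_minus K poly_approximable_const
      poly_approximable_poly)
    fix z assume "z \<in> K"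
    then show "cmod (poly [:0, 1/a:] z) \<le> 1/2"
      using B(2)[of z] na B(1) by (simp add: norm_divide divide_simps)
  qed
  also have "?this \<longleftrightarrow> poly_approximable K (\<lambda>z. 1 / (z - a))"
  proof (rule poly_approximable_cong)
    fix z assume "z \<in> K"
    have "a * (1 - poly [:0, 1/a:] z) = - (z - a)" using na by (simp add: right_diff_distrib)
    then have "(-1/a) * (1 / (1 - poly [:0, 1/a:] z)) = -1 / - (z - a)"
      by (simp only: times_divide_times_eq mult_1_right)
    then show "(-1/a) * (1 / (1 - poly [:0, 1/a:] z)) = 1 / (z - a)"
      by (simp only: minus_divide_divide)
  qed
  finally have Pa: "poly_approximable K (\<lambda>z. 1 / (z - a))" .
  have cl: "closed K" using K(1) by (rule compact_imp_closed)
  show ?thesis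
  proof (rule connected_induction_simple[OF K(2) aK, where P = "\<lambda>b. poly_approximable K (\<lambda>z. 1 / (z - b))"])
    show "b \<in> - K" using b by simp
    fix c assume c: "c \<in> - K"
    then obtain d where d: "d > 0" "ball c d \<subseteq> - K"
      using cl open_contains_ball by (metis open_Compl)
    show "\<exists>T. openin (top_of_set (- K)) T \<and> c \<in> T \<and>
        (\<forall>x\<in>T. \<forall>y\<in>T. poly_approximable K (\<lambda>z. 1 / (z - x)) \<longrightarrow> poly_approximable K (\<lambda>z. 1 / (z - y)))"
    proof (intro exI conjI ballI impI)
      \<comment> \<open>The radius \<open>d/8\<close> makes any two points of the small ball at least twice as close to each other
        as to \<open>K\<close>, so that poles can be moved in both directions.\<close>
      show "openin (top_of_set (- K)) (ball c (d/8))"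
        using d subset_ball[of "d/8" d c] by (intro open_subset) auto
      show "c \<in> ball c (d/8)" using d by simp
      fix x y assume xy: "x \<in> ball c (d/8)" "y \<in> ball c (d/8)" "poly_approximable K (\<lambda>z. 1 / (z - x))"
      show "poly_approximable K (\<lambda>z. 1 / (z - y))"
      proof (rule poly_approximable_move_pole[OF K(1) xy(3)])
        have "x \<in> ball c d" using xy d by auto
        then show "x \<notin> K" using d by auto
        fix z assume "z \<in> K"
        then have "d \<le> dist c z" using d by (force simp: not_less)
        moreover have "dist c x < d/8" "dist c y < d/8" using xy by auto
        moreover have "dist c z \<le> dist c x + dist x z" by (rule dist_triangle)
        moreover have "dist y x \<le> dist c y + dist c x" by (metis dist_commute dist_triangle)
        ultimately have "2 * dist y x \<le> dist x z" using d(1) by linarith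
        then show "2 * cmod (y - x) \<le> cmod (z - x)"
          by (simp add: dist_norm norm_minus_commute)
      qed
    qed
  qed (rule Pa)
qed

lemma integral_near_Riemann_sum:
  fixes F :: "real \<Rightarrow> complex"
  assumes F: "continuous_on {0..1} F" and n: "n > 0"
    and e: "\<And>s t. s \<in> {0..1} \<Longrightarrow> t \<in> {0..1} \<Longrightarrow> \<bar>s - t\<bar> \<le> 1 / real n \<Longrightarrow> cmod (F s - F t) \<le> e"
  shows "cmod (integral {0..1} F - (\<Sum>k<n. F (real k / real n) / of_nat n)) \<le> e"
proof -
  define x where "x k = real k / real n" for k
  have "cmod (integral {0..x m} F - (\<Sum>k<m. F (x k) / of_nat n)) \<le> real m * (e / real n)" if "m \<le> n" for m
    using that
  proof (induction m)
    case 0 then show ?case by (simp add: x_def)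
  next
    case (Suc m)
    have x: "0 \<le> x m" "x m \<le> x (Suc m)" "x (Suc m) \<le> 1" "x (Suc m) - x m = 1 / real n"
      using Suc.prems n by (auto simp: x_def field_simps)
    have int: "F integrable_on {0..x (Suc m)}" "F integrable_on {x m..x (Suc m)}"
      by (rule integrable_continuous_interval; rule continuous_on_subset[OF F]; use x in force)+
    have 1: "integral {0..x (Suc m)} F = integral {0..x m} F + integral {x m..x (Suc m)} F"
      by (rule Henstock_Kurzweil_Integration.integral_combine[symmetric]) (use x int in auto)
    have "integral {x m..x (Suc m)} (\<lambda>t. F t - F (x m))
        = integral {x m..x (Suc m)} F - integral {x m..x (Suc m)} (\<lambda>t. F (x m))"
      by (rule Henstock_Kurzweil_Integration.integral_diff) (use int in auto)
    also have "integral {x m..x (Suc m)} (\<lambda>t. F (x m)) = F (x m) / of_nat n"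
      using x by (simp add: scaleR_conv_of_real)
    finally have 2: "integral {x m..x (Suc m)} (\<lambda>t. F t - F (x m))
        = integral {x m..x (Suc m)} F - F (x m) / of_nat n" .
    have "cmod (integral {x m..x (Suc m)} (\<lambda>t. F t - F (x m))) \<le> e * (x (Suc m) - x m)"
    proof (rule integral_bound)
      show "continuous_on {x m..x (Suc m)} (\<lambda>t. F t - F (x m))"
        by (intro continuous_intros continuous_on_subset[OF F]) (use x in force)
      fix t assume "t \<in> {x m..x (Suc m)}"
      then show "cmod (F t - F (x m)) \<le> e" using x by (intro e) auto
    qed (use x in auto)
    then have 3: "cmod (integral {x m..x (Suc m)} F - F (x m) / of_nat n) \<le> e / real n"
      using 2 x by simp
    have IH: "cmod (integral {0..x m} F - (\<Sum>k<m. F (x k) / of_nat n)) \<le> real m * (e / real n)"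
      using Suc by simp
    have "integral {0..x (Suc m)} F - (\<Sum>k<Suc m. F (x k) / of_nat n)
       = (integral {0..x m} F - (\<Sum>k<m. F (x k) / of_nat n)) + (integral {x m..x (Suc m)} F - F (x m) / of_nat n)"
      using 1 by simp
    then have "cmod (integral {0..x (Suc m)} F - (\<Sum>k<Suc m. F (x k) / of_nat n))
        \<le> real m * (e / real n) + e / real n"
      using IH 3 norm_triangle_mono by metis
    then show ?case by (simp add: algebra_simps add_divide_distrib)
  qed
  from this[of n] show ?thesis using n by (simp add: x_def)
qed

text \<open>
  Riemann sums of the integral are finite combinations of the approximable functions \<open>G t\<close>, and they
  converge uniformly in \<open>z\<close> because \<open>G\<close> is uniformly continuous.
\<close>

lemma poly_approximable_integral:
  fixes G :: "real \<Rightarrow> complex \<Rightarrow> complex"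
  assumes K: "compact K" and G: "continuous_on ({0..1} \<times> K) (\<lambda>(t, z). G t z)"
    and P: "\<And>t. t \<in> {0..1} \<Longrightarrow> poly_approximable K (G t)"
  shows "poly_approximable K (\<lambda>z. integral {0..1} (\<lambda>t. G t z))"
proof (rule poly_approximable_uniform_limit)
  fix e :: real assume e: "e > 0"
  have "uniformly_continuous_on ({0..1} \<times> K) (\<lambda>(t, z). G t z)"
    by (intro compact_uniformly_continuous G compact_Times K) auto
  then obtain d where d: "d > 0"
    and d': "\<And>p q. p \<in> {0..1} \<times> K \<Longrightarrow> q \<in> {0..1} \<times> K \<Longrightarrow> dist q p < d \<Longrightarrow>
        dist (case_prod G q) (case_prod G p) < e / 2"
    unfolding uniformly_continuous_on_def using e by (metis (no_types, lifting) half_gt_zero)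
  obtain n :: nat where n: "n > 0" "1 / real n < d"
    using d by (metis nat_approx_posE zero_less_Suc)
  show "\<exists>\<psi>. poly_approximable K \<psi> \<and> (\<forall>z\<in>K. cmod (integral {0..1} (\<lambda>t. G t z) - \<psi> z) < e)"
  proof (intro exI conjI ballI)
    show "poly_approximable K (\<lambda>z. \<Sum>k<n. (1 / of_nat n) * G (real k / real n) z)"
      using n by (intro poly_approximable_sum poly_approximable_cmult K P) auto
    fix z assume z: "z \<in> K"
    have "cmod (integral {0..1} (\<lambda>t. G t z) - (\<Sum>k<n. G (real k / real n) z / of_nat n)) \<le> e / 2"
    proof (rule integral_near_Riemann_sum[OF _ n(1)])
      have "continuous_on {0..1} (\<lambda>t. (t, z))" by (intro continuous_intros)
      then have "continuous_on {0..1} ((\<lambda>(t, z). G t z) \<circ> (\<lambda>t. (t, z)))"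
        by (rule continuous_on_compose) (rule continuous_on_subset[OF G], use z in auto)
      then show "continuous_on {0..1} (\<lambda>t. G t z)" by (simp add: o_def)
      fix s t :: real assume st: "s \<in> {0..1}" "t \<in> {0..1}" "\<bar>s - t\<bar> \<le> 1 / real n"
      then have "dist (s, z) (t, z) < d"
        using n by (simp add: dist_Pair_Pair dist_real_def)
      then show "cmod (G s z - G t z) \<le> e / 2"
        using d'[of "(t, z)" "(s, z)"] st z by (simp add: dist_norm)
    qed
    then show "cmod (integral {0..1} (\<lambda>t. G t z) - (\<Sum>k<n. (1 / of_nat n) * G (real k / real n) z)) < e"
      using e by simp
  qed
qed

lemma poly_approximable_Cauchy_segment:
  assumes K: "compact K" "connected (- K)" and \<phi>: "continuous_on (closed_segment a b) \<phi>"
    and disj: "closed_segment a b \<inter> K = {}"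
  shows "poly_approximable K (\<lambda>z. contour_integral (linepath a b) (\<lambda>w. \<phi> w / (w - z)))"
proof -
  define G where "G t z = \<phi> (linepath a b t) / (linepath a b t - z) * (b - a)" for t z
  have lp: "linepath a b t \<in> closed_segment a b" if "t \<in> {0..1}" for t
    using that by (metis image_eqI linepath_image_01)
  have "poly_approximable K (\<lambda>z. integral {0..1} (\<lambda>t. G t z))"
  proof (rule poly_approximable_integral[OF K(1)])
    have c: "continuous_on ({0..1} \<times> K) (\<lambda>p. \<phi> (linepath a b (fst p)))"
    proof (rule continuous_on_compose2[OF \<phi>])
      show "continuous_on ({0..1} \<times> K) (\<lambda>p. linepath a b (fst p))"
        by (intro continuous_on_compose2[OF continuous_on_linepath[of UNIV]] continuous_intros) auto
    qed (use lp in auto)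
    have "continuous_on ({0..1} \<times> K) (\<lambda>p. \<phi> (linepath a b (fst p)) / (linepath a b (fst p) - snd p) * (b - a))"
    proof (intro continuous_intros c)
      show "continuous_on ({0..1} \<times> K) (\<lambda>p. linepath a b (fst p))"
        by (intro continuous_on_compose2[OF continuous_on_linepath[of UNIV]] continuous_intros) auto
      show "\<forall>p\<in>{0..1} \<times> K. linepath a b (fst p) - snd p \<noteq> 0"
        using lp disj by force
    qed
    then show "continuous_on ({0..1} \<times> K) (\<lambda>(t, z). G t z)"
      by (simp add: G_def case_prod_beta)
    fix t :: real assume t: "t \<in> {0..1}"
    define w where "w = linepath a b t"
    have "w \<notin> K" using lp[OF t] disj by (auto simp: w_def)
    then have "poly_approximable K (\<lambda>z. (- \<phi> w * (b - a)) * (1 / (z - w)))"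
      by (intro poly_approximable_cmult poly_approximable_inverse K)
    also have "?this \<longleftrightarrow> poly_approximable K (G t)"
    proof (rule poly_approximable_cong)
      fix z assume "z \<in> K"
      then have "z - w \<noteq> 0" "w - z \<noteq> 0" using \<open>w \<notin> K\<close> by auto
      then show "(- \<phi> w * (b - a)) * (1 / (z - w)) = G t z"
        unfolding G_def w_def[symmetric] by (simp add: divide_simps) (simp add: algebra_simps)
    qed
    finally show "poly_approximable K (G t)" .
  qed
  also have "(\<lambda>z. integral {0..1} (\<lambda>t. G t z)) = (\<lambda>z. contour_integral (linepath a b) (\<lambda>w. \<phi> w / (w - z)))"
    by (simp add: contour_integral_integral G_def)
  finally show ?thesis .
qed

lemma isCont_Cauchy_segment:
  assumes \<phi>: "continuous_on (closed_segment a b) \<phi>" and z: "z \<notin> closed_segment a b"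
  shows "isCont (\<lambda>z. contour_integral (linepath a b) (\<lambda>w. \<phi> w / (w - z))) z"
proof -
  have "((\<lambda>z. contour_integral (linepath a b) (\<lambda>w. \<phi> w / (w - z))) has_field_derivative
        (of_nat 1 * contour_integral (linepath a b) (\<lambda>u. \<phi> u / (u - z) ^ Suc 1))) (at z)"
  proof (rule Cauchy_next_derivative(2)[where B = "cmod (b - a)" and S = UNIV])
    fix w assume "w \<in> UNIV - path_image (linepath a b)"
    then have "(\<lambda>u. \<phi> u / (u - w) ^ 1) contour_integrable_on linepath a b"
      by (intro contour_integrable_continuous_linepath continuous_intros \<phi>) auto
    then show "((\<lambda>u. \<phi> u / (u - w) ^ 1) has_contour_integral
        contour_integral (linepath a b) (\<lambda>x. \<phi> x / (x - w))) (linepath a b)"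
      using has_contour_integral_integral by fastforce
  qed (use \<phi> z in auto)
  then show ?thesis by (rule DERIV_isCont)
qed

section \<open>Runge's theorem\<close>

lemma open_contains_uniform_ball:
  assumes "compact K" "open U" "K \<subseteq> U"
  obtains d where "d > 0" "\<And>x y. x \<in> K \<Longrightarrow> dist x y < d \<Longrightarrow> y \<in> U"
proof -
  obtain e where "e > 0" "(\<Union>x\<in>K. ball x e) \<subseteq> U"
    using compact_subset_open_imp_ball_epsilon_subset[OF assms] by blast
  then show ?thesis using that[of e] by (auto simp: subset_iff)
qed

text \<open>
  A grid of small squares is laid over the plane.  Adding the Cauchy integrals over the boundaries of
  all squares that meet \<open>K\<close>, the edges between two such squares cancel.  What is left are integrals over
  edges that avoid \<open>K\<close>, and each of these is approximable by pole pushing.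
\<close>

theorem Runge_polynomial:
  assumes K: "compact K" "connected (- K)" and U: "open U" "K \<subseteq> U" and \<phi>: "\<phi> holomorphic_on U"
  shows "poly_approximable K \<phi>"
proof -
  obtain d where d: "d > 0" and dU: "\<And>x y. x \<in> K \<Longrightarrow> dist x y < d \<Longrightarrow> y \<in> U"
    using open_contains_uniform_ball[OF K(1) U] by metis
  \<comment> \<open>A square of side \<open>d/3\<close> has diameter less than \<open>d\<close>, so a square that meets \<open>K\<close> lies in \<open>U\<close>.\<close>
  define s where "s = d / 3"
  have s: "s > 0" using d by (simp add: s_def)
  define g where "g i j = Complex (s * of_int i) (s * of_int j)" for i j :: int
  define Q where "Q i j = cbox (g i j) (g (i+1) (j+1))" for i j
  define S where "S = {(i, j). Q i j \<inter> K \<noteq> {}}"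
  have Re_g [simp]: "Re (g i j) = s * of_int i" and Im_g [simp]: "Im (g i j) = s * of_int j" for i j
    by (simp_all add: g_def)
  have Q_iff: "w \<in> Q i j \<longleftrightarrow> s * of_int i \<le> Re w \<and> Re w \<le> s * of_int (i+1) \<and>
      s * of_int j \<le> Im w \<and> Im w \<le> s * of_int (j+1)" for w i j
    by (auto simp: Q_def in_cbox_complex_iff)
  have QU: "Q i j \<subseteq> U" if ij: "(i, j) \<in> S" for i j
  proof
    fix y assume y: "y \<in> Q i j"
    obtain x where x: "x \<in> Q i j" "x \<in> K" using ij by (auto simp: S_def)
    have "dist x y \<le> \<bar>Re (x - y)\<bar> + \<bar>Im (x - y)\<bar>"
      unfolding dist_norm by (rule cmod_le)
    also have "\<dots> \<le> s + s"
      using x(1) y by (intro add_mono) (auto simp: Q_iff algebra_simps abs_le_iff)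
    also have "\<dots> < d" using d by (simp add: s_def)
    finally show "y \<in> U" using dU x(2) by blast
  qed
  have "finite S"
  proof -
    obtain B where B: "\<And>z. z \<in> K \<Longrightarrow> cmod z \<le> B"
      by (metis K(1) compact_imp_bounded bounded_iff)
    define N where "N = \<lceil>B / s\<rceil> + 1"
    have "i \<in> {-N..N} \<and> j \<in> {-N..N}" if ij: "(i, j) \<in> S" for i j
    proof -
      obtain x where x: "x \<in> Q i j" "x \<in> K" using ij by (auto simp: S_def)
      have b: "\<bar>Re x\<bar> \<le> B" "\<bar>Im x\<bar> \<le> B"
        using B[OF x(2)] abs_Re_le_cmod[of x] abs_Im_le_cmod[of x] by linarith+
      have ceil: "B / s \<le> of_int \<lceil>B / s\<rceil>" by (rule le_of_int_ceiling)
      have N: "B \<le> s * (of_int N - 1)" using mult_left_mono[OF ceil, of s] s by (simp add: N_def)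
      have *: "-N \<le> k \<and> k \<le> N" if "s * of_int k \<le> t" "t \<le> s * of_int (k+1)" "\<bar>t\<bar> \<le> B" for k t
      proof -
        have "s * of_int k \<le> s * (of_int N - 1)" using that N by linarith
        then have "real_of_int k \<le> of_int N - 1" using s by simp
        moreover have "s * (1 - of_int N) \<le> s * of_int (k+1)" using that N by (simp add: algebra_simps)
        then have "1 - real_of_int N \<le> of_int (k+1)" using s mult_le_cancel_left_pos by blast
        ultimately show ?thesis by (simp add: algebra_simps)
      qed
      show ?thesis using *[of i "Re x"] *[of j "Im x"] x(1) b by (auto simp: Q_iff)
    qed
    then have "S \<subseteq> {-N..N} \<times> {-N..N}" by auto
    then show ?thesis by (rule finite_subset) auto
  qed
  define H where "H = (\<lambda>(i, j) z. contour_integral (linepath (g i j) (g (i+1) j)) (\<lambda>w. \<phi> w / (w - z)))"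
  define V where "V = (\<lambda>(i, j) z. contour_integral (linepath (g i j) (g i (j+1))) (\<lambda>w. \<phi> w / (w - z)))"
  define up :: "int \<times> int \<Rightarrow> int \<times> int" where "up = (\<lambda>(i, j). (i, j+1))"
  define rt :: "int \<times> int \<Rightarrow> int \<times> int" where "rt = (\<lambda>(i, j). (i+1, j))"
  \<comment> \<open>The sum of the four edge integrals over all squares in \<open>S\<close> after cancellation.  The top edge of
    a square is the bottom edge of the square above it, whence the images of \<open>S\<close> under the shifts
    \<open>up\<close> and \<open>rt\<close>.\<close>
  define \<Psi> where "\<Psi> z = (\<Sum>e\<in>S - up ` S. H e z) - (\<Sum>e\<in>up ` S - S. H e z)
      + ((\<Sum>e\<in>rt ` S - S. V e z) - (\<Sum>e\<in>S - rt ` S. V e z))" for z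
  have segQ: "closed_segment a b \<subseteq> Q i j" if "a \<in> Q i j" "b \<in> Q i j" for a b i j
    using that unfolding Q_def by (intro closed_segment_subset) auto
  have corner: "g i' j' \<in> Q i j" if "i' \<in> {i, i+1}" "j' \<in> {j, j+1}" for i j i' j'
    using that s by (auto simp: Q_iff)
  have hseg: "closed_segment (g i j) (g (i+1) j) \<subseteq> Q i j \<inter> Q i (j-1)" for i j
    by (intro Int_greatest segQ corner) auto
  have vseg: "closed_segment (g i j) (g i (j+1)) \<subseteq> Q i j \<inter> Q (i-1) j" for i j
    by (intro Int_greatest segQ corner) auto
  \<comment> \<open>A surviving edge borders exactly one square of \<open>S\<close>: it lies in \<open>U\<close> because of this square, and it
    misses \<open>K\<close> because of its other neighbour.\<close>
  have edgeH: "closed_segment (g i j) (g (i+1) j) \<subseteq> U - K"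
    if "(i, j) \<in> (S - up ` S) \<union> (up ` S - S)" for i j
  proof -
    have m: "(i, j) \<in> up ` S \<longleftrightarrow> (i, j - 1) \<in> S" by (force simp: up_def)
    have "Q i j \<subseteq> U \<and> Q i (j-1) \<inter> K = {} \<or> Q i (j-1) \<subseteq> U \<and> Q i j \<inter> K = {}"
      using that m QU[of i j] QU[of i "j-1"] by (auto simp: S_def)
    then show ?thesis using hseg[of i j] by blast
  qed
  have edgeV: "closed_segment (g i j) (g i (j+1)) \<subseteq> U - K"
    if "(i, j) \<in> (S - rt ` S) \<union> (rt ` S - S)" for i j
  proof -
    have m: "(i, j) \<in> rt ` S \<longleftrightarrow> (i - 1, j) \<in> S" by (force simp: rt_def)
    have "Q i j \<subseteq> U \<and> Q (i-1) j \<inter> K = {} \<or> Q (i-1) j \<subseteq> U \<and> Q i j \<inter> K = {}"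
      using that m QU[of i j] QU[of "i-1" j] by (auto simp: S_def)
    then show ?thesis using vseg[of i j] by blast
  qed
  have cont\<phi>: "continuous_on T \<phi>" if "T \<subseteq> U" for T
    using holomorphic_on_imp_continuous_on[OF \<phi>] that continuous_on_subset by blast
  have HP: "poly_approximable K (H e)" "\<And>z. z \<in> K \<Longrightarrow> isCont (H e) z"
    if "e \<in> (S - up ` S) \<union> (up ` S - S)" for e
    using that edgeH[of "fst e" "snd e"] cont\<phi>
    by (auto simp: H_def case_prod_beta intro!: poly_approximable_Cauchy_segment K isCont_Cauchy_segment)
  have VP: "poly_approximable K (V e)" "\<And>z. z \<in> K \<Longrightarrow> isCont (V e) z"
    if "e \<in> (S - rt ` S) \<union> (rt ` S - S)" for e
    using that edgeV[of "fst e" "snd e"] cont\<phi>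
    by (auto simp: V_def case_prod_beta intro!: poly_approximable_Cauchy_segment K isCont_Cauchy_segment)
  have \<Psi>P: "poly_approximable K \<Psi>"
  proof -
    have "poly_approximable K (\<lambda>z. ((\<Sum>e\<in>S - up ` S. H e z) + (-1) * (\<Sum>e\<in>up ` S - S. H e z))
      + ((\<Sum>e\<in>rt ` S - S. V e z) + (-1) * (\<Sum>e\<in>S - rt ` S. V e z)))"
      using HP(1) VP(1)
      by (intro poly_approximable_add poly_approximable_cmult poly_approximable_sum K) blast+
    then show ?thesis by (simp add: \<Psi>_def[abs_def])
  qed
  have \<Psi>C: "isCont \<Psi> z" if "z \<in> K" for z
    unfolding \<Psi>_def[abs_def] using HP(2) VP(2) that by (intro continuous_intros) blast+
  \<comment> \<open>Off the grid lines Cauchy's formula applies to every square: only the one containing \<open>z\<close>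
    contributes.\<close>
  have off_grid: "\<Psi> z = 2 * pi * \<i> * \<phi> z" if ab: "(a, b) \<in> S" and z: "z \<in> box (g a b) (g (a+1) (b+1))" for a b z
  proof -
    have zin: "s * of_int a < Re z" "Re z < s * of_int (a+1)" "s * of_int b < Im z" "Im z < s * of_int (b+1)"
      using z by (auto simp: in_box_complex_iff)
    have uniq: "k = m" if "s * of_int m < t" "t < s * of_int (m+1)" "s * of_int k \<le> t" "t \<le> s * of_int (k+1)"
      for k m :: int and t
    proof -
      have "s * of_int m < s * of_int (k+1)" "s * of_int k < s * of_int (m+1)" using that by linarith+
      then have "real_of_int m < of_int (k+1)" "real_of_int k < of_int (m+1)" using s mult_less_cancel_left_pos by blast+
      then show ?thesis by linarith
    qed
    have zQ: "i = a \<and> j = b" if "z \<in> Q i j" for i j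
      using that zin uniq[of a "Re z" i] uniq[of b "Im z" j] by (auto simp: Q_iff)
    have nh: "z \<notin> closed_segment (g i j) (g (i+1) j)" for i j
    proof
      assume "z \<in> closed_segment (g i j) (g (i+1) j)"
      then have "z \<in> Q i j" "z \<in> Q i (j-1)" using hseg[of i j] by blast+
      then show False using zQ[of i j] zQ[of i "j-1"] by simp
    qed
    have nv: "z \<notin> closed_segment (g i j) (g i (j+1))" for i j
    proof
      assume "z \<in> closed_segment (g i j) (g i (j+1))"
      then have "z \<in> Q i j" "z \<in> Q (i-1) j" using vseg[of i j] by blast+
      then show False using zQ[of i j] zQ[of "i-1" j] by simp
    qed
    have rect: "H (i, j) z + V (i+1, j) z - H (i, j+1) z - V (i, j) z
        = (if (i, j) = (a, b) then 2 * pi * \<i> * \<phi> z else 0)" if ij: "(i, j) \<in> S" for i j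
    proof -
      define F where "F w = \<phi> w / (w - z)" for w
      have seg: "F contour_integrable_on linepath x y"
        if "closed_segment x y \<subseteq> Q i j" "z \<notin> closed_segment x y" for x y
        unfolding F_def using that QU[OF ij]
        by (intro contour_integrable_continuous_linepath continuous_intros cont\<phi>) auto
      have cs: "g (i+1) j = Complex (Re (g (i+1) (j+1))) (Im (g i j))"
           "g i (j+1) = Complex (Re (g i j)) (Im (g (i+1) (j+1)))" by (simp_all add: g_def)
      have R: "rectpath (g i j) (g (i+1) (j+1)) = linepath (g i j) (g (i+1) j) +++
          linepath (g (i+1) j) (g (i+1) (j+1)) +++ linepath (g (i+1) (j+1)) (g i (j+1)) +++ linepath (g i (j+1)) (g i j)"
        unfolding rectpath_def Let_def cs[symmetric] ..
      have I1: "F contour_integrable_on linepath (g i j) (g (i+1) j)"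
        by (intro seg segQ corner nh) auto
      have I2: "F contour_integrable_on linepath (g (i+1) j) (g (i+1) (j+1))"
        by (intro seg segQ corner nv) auto
      have I3: "F contour_integrable_on linepath (g i (j+1)) (g (i+1) (j+1))"
        by (intro seg segQ corner nh) auto
      have I4: "F contour_integrable_on linepath (g i j) (g i (j+1))"
        by (intro seg segQ corner nv) auto
      have I3': "F contour_integrable_on linepath (g (i+1) (j+1)) (g i (j+1))"
        and I4': "F contour_integrable_on linepath (g i (j+1)) (g i j)"
        using I3 I4 by (metis contour_integrable_reversepath reversepath_linepath valid_path_linepath)+
      have e3: "contour_integral (linepath (g (i+1) (j+1)) (g i (j+1))) F
          = - contour_integral (linepath (g i (j+1)) (g (i+1) (j+1))) F"
        and e4: "contour_integral (linepath (g i (j+1)) (g i j)) F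
          = - contour_integral (linepath (g i j) (g i (j+1))) F"
        by (metis contour_integral_reversepath reversepath_linepath valid_path_linepath)+
      have "contour_integral (rectpath (g i j) (g (i+1) (j+1))) F
          = H (i, j) z + V (i+1, j) z - H (i, j+1) z - V (i, j) z"
        unfolding R using I1 I2 I3' I4'
        by (simp add: contour_integrable_joinI valid_path_join e3[unfolded F_def[abs_def]] e4[unfolded F_def[abs_def]]
              H_def V_def F_def[abs_def])
      moreover have "contour_integral (rectpath (g i j) (g (i+1) (j+1))) F
          = (if (i, j) = (a, b) then 2 * pi * \<i> * \<phi> z else 0)"
      proof (cases "(i, j) = (a, b)")
        case True
        have "((\<lambda>w. \<phi> w / (w - z)) has_contour_integral
            2 * pi * \<i> * winding_number (rectpath (g i j) (g (i+1) (j+1))) z * \<phi> z) (rectpath (g i j) (g (i+1) (j+1)))"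
        proof (rule Cauchy_integral_formula_convex_simple)
          show "convex (Q i j)" by (simp add: Q_def convex_box)
          show "\<phi> holomorphic_on Q i j" using holomorphic_on_subset[OF \<phi> QU[OF ij]] .
          show "z \<in> interior (Q i j)" using z True by (simp add: Q_def interior_cbox)
          show "path_image (rectpath (g i j) (g (i+1) (j+1))) \<subseteq> Q i j - {z}"
            using z True s by (subst path_image_rectpath_cbox_minus_box) (auto simp: Q_def)
        qed auto
        then show ?thesis
          using True z winding_number_rectpath[of z "g a b" "g (a+1) (b+1)"] contour_integral_unique
          by (simp add: F_def[abs_def])
      next
        case False
        then have nz: "z \<notin> Q i j" using zQ by blast
        have "(F has_contour_integral 0) (rectpath (g i j) (g (i+1) (j+1)))"
        proof (rule Cauchy_theorem_convex_simple)
          show "convex (Q i j)" by (simp add: Q_def convex_box)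
          show "F holomorphic_on Q i j"
            unfolding F_def using nz by (intro holomorphic_intros holomorphic_on_subset[OF \<phi> QU[OF ij]]) auto
          show "path_image (rectpath (g i j) (g (i+1) (j+1))) \<subseteq> Q i j"
            unfolding Q_def using s by (intro path_image_rectpath_subset_cbox) auto
        qed auto
        then show ?thesis using False contour_integral_unique by auto
      qed
      ultimately show ?thesis by simp
    qed
    have inj: "inj_on up S" "inj_on rt S" by (auto simp: inj_on_def up_def rt_def)
    have diff: "sum h A - sum h B = sum h (A - B) - sum h (B - A)" if "finite A" "finite B"
      for h :: "int \<times> int \<Rightarrow> complex" and A B
      using that sum.Int_Diff[of A h B] sum.Int_Diff[of B h A] by (simp add: Int_commute)
    have "\<Psi> z = ((\<Sum>e\<in>S. H e z) - (\<Sum>e\<in>up ` S. H e z)) + ((\<Sum>e\<in>rt ` S. V e z) - (\<Sum>e\<in>S. V e z))"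
      unfolding \<Psi>_def using \<open>finite S\<close> by (subst (1 2) diff) auto
    also have "\<dots> = (\<Sum>e\<in>S. H e z + V (rt e) z - H (up e) z - V e z)"
      by (simp add: sum.reindex inj sum.distrib sum_subtractf)
    also have "\<dots> = (\<Sum>e\<in>S. if e = (a, b) then 2 * pi * \<i> * \<phi> z else 0)"
    proof (rule sum.cong)
      fix e assume "e \<in> S"
      then show "H e z + V (rt e) z - H (up e) z - V e z = (if e = (a, b) then 2 * pi * \<i> * \<phi> z else 0)"
        using rect[of "fst e" "snd e"] by (cases e) (auto simp: rt_def up_def)
    qed auto
    also have "\<dots> = 2 * pi * \<i> * \<phi> z" using \<open>finite S\<close> ab by simp
    finally show ?thesis .
  qed
  \<comment> \<open>A point of \<open>K\<close> may lie on a grid line.  It is then approached along the diagonal from inside one of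
    the adjacent squares, which belongs to \<open>S\<close> since it contains the point.\<close>
  have \<Psi>eq: "\<Psi> z = 2 * pi * \<i> * \<phi> z" if z: "z \<in> K" for z
  proof -
    define a where "a = \<lfloor>Re z / s\<rfloor>"
    define b where "b = \<lfloor>Im z / s\<rfloor>"
    define D where "D w = \<Psi> w - 2 * pi * \<i> * \<phi> w" for w
    have fl: "s * of_int \<lfloor>t / s\<rfloor> \<le> t \<and> t < s * (of_int \<lfloor>t / s\<rfloor> + 1)" for t
    proof -
      have "s * of_int \<lfloor>t / s\<rfloor> \<le> s * (t / s)" "s * (t / s) < s * (of_int \<lfloor>t / s\<rfloor> + 1)"
        using s by (intro mult_left_mono mult_strict_left_mono; linarith)+
      then show ?thesis using s by simp
    qed
    have ab: "s * of_int a \<le> Re z" "Re z < s * (of_int a + 1)" "s * of_int b \<le> Im z" "Im z < s * (of_int b + 1)"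
      using fl[of "Re z"] fl[of "Im z"] by (auto simp: a_def b_def)
    have "z \<in> Q a b" using ab by (auto simp: Q_iff)
    then have S: "(a, b) \<in> S" using z by (auto simp: S_def)
    have "isCont \<phi> z"
      using holomorphic_on_imp_continuous_on[OF \<phi>] U z continuous_on_eq_continuous_at by blast
    then have D: "isCont D z" unfolding D_def using \<Psi>C[OF z] by (intro continuous_intros) auto
    have "((\<lambda>t. z + of_real t * Complex 1 1) \<longlongrightarrow> z + of_real 0 * Complex 1 1) (at_right 0)"
      by (intro tendsto_intros)
    then have "((\<lambda>t. D (z + of_real t * Complex 1 1)) \<longlongrightarrow> D z) (at_right 0)"
      by (intro isCont_tendsto_compose[OF D]) simp
    moreover have "\<forall>\<^sub>F t in at_right 0. D (z + of_real t * Complex 1 1) = 0"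
    proof -
      define \<epsilon> where "\<epsilon> = min (s * (of_int a + 1) - Re z) (s * (of_int b + 1) - Im z)"
      have "\<epsilon> > 0" using ab by (simp add: \<epsilon>_def)
      then have "\<forall>\<^sub>F t in at_right 0. 0 < t \<and> t < \<epsilon>"
        by (auto simp: eventually_at_right_field intro!: exI[of _ \<epsilon>])
      then show ?thesis
      proof eventually_elim
        case (elim t)
        then have "z + of_real t * Complex 1 1 \<in> box (g a b) (g (a+1) (b+1))"
          using ab by (auto simp: in_box_complex_iff \<epsilon>_def)
        then show ?case using off_grid[OF S] by (simp add: D_def)
      qed
    qed
    then have "((\<lambda>t. D (z + of_real t * Complex 1 1)) \<longlongrightarrow> 0) (at_right 0)"
      by (rule tendsto_eventually)
    ultimately have "D z = 0" using tendsto_unique trivial_limit_at_right_real by blast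
    then show ?thesis by (simp add: D_def)
  qed
  have "poly_approximable K (\<lambda>z. (1 / (2 * pi * \<i>)) * \<Psi> z)"
    using \<Psi>P K(1) by (rule poly_approximable_cmult)
  also have "?this \<longleftrightarrow> ?thesis"
    by (rule poly_approximable_cong) (simp add: \<Psi>eq)
  finally show ?thesis .
qed

section \<open>Nonseparating compact sets in the plane\<close>

text \<open>
  Adding to a compact set the bounded components of its complement, its inside, is the canonical way
  to make it nonseparating.
\<close>

lemma compact_Un_inside:
  fixes K :: "complex set"
  assumes "compact K"
  shows "compact (K \<union> inside K)"
  unfolding compact_eq_bounded_closed
proof
  show "bounded (K \<union> inside K)"
    using assms by (simp add: compact_imp_bounded bounded_inside)
  show "closed (K \<union> inside K)"
    using assms by (simp add: union_with_inside closed_Compl open_outside compact_imp_closed)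
qed

lemma connected_Compl_Un_inside:
  fixes K :: "complex set"
  assumes "compact K"
  shows "connected (- (K \<union> inside K))"
  using assms by (simp add: union_with_inside connected_outside compact_imp_bounded)

text \<open>
  The number of complementary components of a compact set is a topological invariant of the set.
\<close>

lemma nonseparating_inj_image:
  fixes K :: "complex set" and f :: "complex \<Rightarrow> complex"
  assumes K: "compact K" "connected (- K)" and f: "continuous_on K f" "inj_on f K"
  shows "connected (- (f ` K))"
proof -
  have "K homeomorphic f ` K"
    using homeomorphic_compact[OF K(1) f(1) refl f(2)] .
  then show ?thesis
    using homotopy_eqv_separation[of K "f ` K"] homeomorphic_imp_homotopy_eqv K
      compact_continuous_image[OF f(1) K(1)] by blast
qed

lemma nonseparating_disjoint_Union:
  fixes K :: "'i \<Rightarrow> complex set"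
  assumes "finite I" "\<And>i. i \<in> I \<Longrightarrow> compact (K i)" "\<And>i. i \<in> I \<Longrightarrow> connected (- K i)"
    "\<And>i j. i \<in> I \<Longrightarrow> j \<in> I \<Longrightarrow> i \<noteq> j \<Longrightarrow> K i \<inter> K j = {}"
  shows "connected (- (\<Union>i\<in>I. K i))"
  using assms
proof (induction I rule: finite_induct)
  case empty
  then show ?case by (simp add: connected_UNIV)
next
  case (insert i I)
  have "compact (\<Union>i\<in>I. K i)" using insert by (intro compact_UN) auto
  moreover have "K i \<inter> (\<Union>i\<in>I. K i) = {}" using insert.prems(3) insert.hyps(2) by fastforce
  moreover have "connected (- (\<Union>i\<in>I. K i))" by (rule insert.IH) (use insert.prems in auto)
  ultimately have "connected (- (K i \<union> (\<Union>i\<in>I. K i)))"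
    using insert.prems by (intro Janiszewski_connected) (auto intro: compact_imp_closed)
  then show ?case by simp
qed

text \<open>
  If \<open>K\<close> is nonseparating, each point of the compact set of those points outside \<open>\<Omega>\<close> that are not far
  away is joined to a far point by a connected set avoiding \<open>K\<close>.  Finitely many such sets suffice by
  compactness, hence all of them stay away from a small neighbourhood of \<open>K\<close>, whose subsets
  therefore cannot enclose any point outside \<open>\<Omega>\<close>.
\<close>

lemma inside_of_neighbourhood:
  fixes K \<Omega> :: "complex set"
  assumes K: "compact K" "connected (- K)" and \<Omega>: "open \<Omega>" "K \<subseteq> \<Omega>"
  obtains d where "d > 0" "\<And>B. (\<And>y. y \<in> B \<Longrightarrow> \<exists>x\<in>K. dist x y < d) \<Longrightarrow> B \<union> inside B \<subseteq> \<Omega>"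
proof -
  have cl: "closed K" using K(1) by (rule compact_imp_closed)
  obtain B0 where B0: "\<And>z. z \<in> K \<Longrightarrow> cmod z \<le> B0" "B0 > 0"
    by (metis K(1) compact_imp_bounded bounded_pos)
  define R where "R = B0 + 1"
  \<comment> \<open>The point \<open>a\<close> lies in the outside of every set in the \<open>1\<close>-neighbourhood of \<open>K\<close>, as such a set is
    contained in the disc of radius \<open>R\<close>.\<close>
  define a :: complex where "a = of_real R"
  define P where "P = cball 0 R - \<Omega>"
  have na: "cmod a = R" using B0 by (simp add: a_def R_def)
  then have aK: "a \<in> - K" using B0(1)[of a] by (auto simp: R_def)
  have "compact P" unfolding P_def using \<Omega> by (intro compact_diff) auto
  have "path_connected (- K)"
    using K cl by (metis connected_open_path_connected open_Compl)
  have "\<exists>C r. r > 0 \<and> ball p r \<subseteq> C \<and> C \<subseteq> - K \<and> a \<in> C \<and> compact C \<and> connected C" if p: "p \<in> P" for p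
  proof -
    have "p \<in> - K" using p \<Omega> by (auto simp: P_def)
    then obtain r where r: "r > 0" "cball p r \<subseteq> - K"
      using cl open_contains_cball by (metis open_Compl)
    obtain \<gamma> where \<gamma>: "path \<gamma>" "path_image \<gamma> \<subseteq> - K" "pathstart \<gamma> = p" "pathfinish \<gamma> = a"
      using \<open>path_connected (- K)\<close> \<open>p \<in> - K\<close> aK unfolding path_connected_def by blast
    have "p \<in> cball p r \<inter> path_image \<gamma>" using \<gamma> r pathstart_in_path_image[of \<gamma>] by auto
    then have "connected (cball p r \<union> path_image \<gamma>)"
      using \<gamma>(1) by (intro connected_Un connected_path_image connected_cball) blast+
    moreover have "a \<in> path_image \<gamma>" using \<gamma> pathfinish_in_path_image by metis
    ultimately show ?thesis
      using r \<gamma> by (intro exI[of _ "cball p r \<union> path_image \<gamma>"] exI[of _ r])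
        (auto simp: compact_Un compact_path_image)
  qed
  then have "\<forall>p\<in>P. \<exists>C r. r > 0 \<and> ball p r \<subseteq> C \<and> C \<subseteq> - K \<and> a \<in> C \<and> compact C \<and> connected C"
    by blast
  then obtain C where "\<forall>p\<in>P. \<exists>r. r > 0 \<and> ball p r \<subseteq> C p \<and> C p \<subseteq> - K \<and> a \<in> C p \<and> compact (C p) \<and> connected (C p)"
    unfolding bchoice_iff by blast
  then obtain r where Cr: "\<forall>p\<in>P. r p > 0 \<and> ball p (r p) \<subseteq> C p \<and> C p \<subseteq> - K \<and> a \<in> C p \<and> compact (C p) \<and> connected (C p)"
    unfolding bchoice_iff by blast
  have C: "\<And>p. p \<in> P \<Longrightarrow> r p > 0" "\<And>p. p \<in> P \<Longrightarrow> ball p (r p) \<subseteq> C p"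
      "\<And>p. p \<in> P \<Longrightarrow> C p \<subseteq> - K" "\<And>p. p \<in> P \<Longrightarrow> a \<in> C p"
      "\<And>p. p \<in> P \<Longrightarrow> compact (C p)" "\<And>p. p \<in> P \<Longrightarrow> connected (C p)"
    using Cr by blast+
  have "P \<subseteq> (\<Union>p\<in>P. ball p (r p))" using C(1) by force
  then obtain F where F: "F \<subseteq> P" "finite F" "P \<subseteq> (\<Union>p\<in>F. ball p (r p))"
    using compactE_image[OF \<open>compact P\<close>, of P "\<lambda>p. ball p (r p)"] by blast
  define Q where "Q = (\<Union>p\<in>F. C p)"
  have "closed Q" unfolding Q_def using F C(5) by (intro compact_imp_closed compact_UN) auto
  moreover have "K \<inter> Q = {}" unfolding Q_def using F C(3) by blast
  ultimately obtain d where d: "d > 0" "\<And>x y. x \<in> K \<Longrightarrow> y \<in> Q \<Longrightarrow> d \<le> dist x y"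
    using separate_compact_closed[OF K(1)] by metis
  obtain d' where d': "d' > 0" "\<And>x y. x \<in> K \<Longrightarrow> dist x y < d' \<Longrightarrow> y \<in> \<Omega>"
    using open_contains_uniform_ball[OF K(1) \<Omega>] by metis
  show ?thesis
  proof
    show "min 1 (min d d') > 0" using d d' by simp
    fix B assume B: "\<And>y. y \<in> B \<Longrightarrow> \<exists>x\<in>K. dist x y < min 1 (min d d')"
    have BQ: "B \<inter> Q = {}" using B d(2) by fastforce
    have "B \<subseteq> ball 0 R"
    proof
      fix y assume "y \<in> B"
      then obtain x where "x \<in> K" "dist x y < 1" using B by force
      then show "y \<in> ball 0 R"
        using B0(1)[of x] norm_triangle_ineq[of x "y - x"] by (simp add: R_def dist_norm norm_minus_commute)
    qed
    then have out: "- ball 0 R \<subseteq> outside B" by (intro outside_subset_convex) auto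
    have "inside B \<subseteq> \<Omega>"
    proof
      fix z assume z: "z \<in> inside B"
      have zo: "z \<notin> outside B" using z inside_Int_outside by blast
      show "z \<in> \<Omega>"
      proof (rule ccontr)
        assume "z \<notin> \<Omega>"
        moreover have "z \<in> ball 0 R" using zo out by blast
        ultimately have "z \<in> P" by (auto simp: P_def)
        then obtain p where p: "p \<in> F" "z \<in> ball p (r p)" using F(3) by blast
        then have pP: "p \<in> P" using F(1) by blast
        then have "z \<in> C p" using C(2) p(2) by blast
        have aout: "a \<in> outside B" using out na by auto
        have "B \<inter> C p \<noteq> {}"
          by (rule inside_outside_intersect_connected[OF C(6)[OF pP]]) (use C(4)[OF pP] z \<open>z \<in> C p\<close> aout in blast)+
        then show False using BQ p by (auto simp: Q_def)
      qed
    qed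
    moreover have "B \<subseteq> \<Omega>" using B d'(2) by fastforce
    ultimately show "B \<union> inside B \<subseteq> \<Omega>" by blast
  qed
qed

text \<open>
  This makes a condition on all nonseparating compact subsets of \<open>\<Omega>\<close> a countable one.  The family
  consists of the filled closures of finite unions of sets from a countable basis, as far as these are
  compact and stay in \<open>\<Omega>\<close>; that there are enough of them is the preceding lemma.
\<close>

lemma countable_cofinal_nonseparating:
  fixes \<Omega> :: "complex set"
  assumes \<Omega>: "open \<Omega>"
  obtains \<K> where "countable \<K>"
    "\<forall>L\<in>\<K>. compact L \<and> connected (- L) \<and> L \<subseteq> \<Omega>"
    "\<forall>K. compact K \<longrightarrow> connected (- K) \<longrightarrow> K \<subseteq> \<Omega> \<longrightarrow> (\<exists>L\<in>\<K>. K \<subseteq> L)"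
proof -
  obtain \<B> :: "complex set set" where \<B>: "countable \<B>" "topological_basis \<B>"
    using ex_countable_basis by blast
  define L where "L F = closure (\<Union>F) \<union> inside (closure (\<Union>F))" for F :: "complex set set"
  define \<K> where "\<K> = L ` {F. F \<subseteq> \<B> \<and> finite F} \<inter> {L. compact L \<and> connected (- L) \<and> L \<subseteq> \<Omega>}"
  show ?thesis
  proof
    show "countable \<K>"
      unfolding \<K>_def using \<B>(1) countable_Collect_finite_subset[of \<B>]
      by (intro countable_Int1 countable_image) (simp add: conj_commute)
    show "\<forall>L\<in>\<K>. compact L \<and> connected (- L) \<and> L \<subseteq> \<Omega>"
      by (auto simp: \<K>_def)
  next
    show "\<forall>K. compact K \<longrightarrow> connected (- K) \<longrightarrow> K \<subseteq> \<Omega> \<longrightarrow> (\<exists>L\<in>\<K>. K \<subseteq> L)"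
    proof (intro allI impI)
      fix K assume K: "compact K" "connected (- K)" "K \<subseteq> \<Omega>"
      obtain d where d: "d > 0" "\<And>B. (\<And>y. y \<in> B \<Longrightarrow> \<exists>x\<in>K. dist x y < d) \<Longrightarrow> B \<union> inside B \<subseteq> \<Omega>"
        using inside_of_neighbourhood[OF K(1,2) \<Omega> K(3)] by metis
      define N where "N = (\<Union>x\<in>K. ball x (d/2))"
      have "\<exists>b\<in>\<B>. x \<in> b \<and> b \<subseteq> N" if "x \<in> K" for x
      proof -
        have "open N" by (auto simp: N_def)
        moreover have "x \<in> N" unfolding N_def using that d(1) by (intro UN_I[of x]) auto
        ultimately show ?thesis using topological_basisE[OF \<B>(2)] by metis
      qed
      then have cover: "K \<subseteq> \<Union>{b \<in> \<B>. b \<subseteq> N}" by blast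
      have opens: "open b" if "b \<in> {b \<in> \<B>. b \<subseteq> N}" for b
        using topological_basis_open[OF \<B>(2)] that by blast
      obtain F where F: "F \<subseteq> {b \<in> \<B>. b \<subseteq> N}" "finite F" "K \<subseteq> \<Union>F"
        by (rule compactE[OF K(1) cover opens])
      have near: "\<exists>x\<in>K. dist x y < d" if y: "y \<in> closure (\<Union>F)" for y
      proof -
        obtain w where w: "w \<in> \<Union>F" "dist w y < d/2"
          using y d(1) unfolding closure_approachable by (metis half_gt_zero)
        then have "w \<in> N" using F(1) by blast
        then obtain x where x: "x \<in> K" "dist x w < d/2" unfolding N_def by auto
        then show ?thesis using w(2) dist_triangle[of x y w] by (intro bexI[of _ x]) auto
      qed
      have sub: "L F \<subseteq> \<Omega>" unfolding L_def using near by (rule d(2))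
      have "bounded (closure (\<Union>F))"
      proof -
        obtain M where M: "\<And>x. x \<in> K \<Longrightarrow> cmod x \<le> M" by (metis K(1) compact_imp_bounded bounded_iff)
        show ?thesis
          unfolding bounded_iff
        proof (intro exI ballI)
          fix y assume "y \<in> closure (\<Union>F)"
          then obtain x where "x \<in> K" "dist x y < d" using near by blast
          then show "cmod y \<le> M + d"
            using M[of x] norm_triangle_ineq[of x "y - x"] by (simp add: dist_norm norm_minus_commute)
        qed
      qed
      then have "compact (closure (\<Union>F))" by (simp add: compact_eq_bounded_closed)
      then have "L F \<in> \<K>"
        using F sub by (auto simp: \<K>_def L_def compact_Un_inside connected_Compl_Un_inside simp del: compl_sup)
      moreover have "K \<subseteq> L F" using F(3) closure_subset by (fastforce simp: L_def)
      ultimately show "\<exists>L\<in>\<K>. K \<subseteq> L" by blast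
    qed
  qed
qed

section \<open>Open sets without holes\<close>

lemma continuous_on_Fin: "continuous_on A Fin"
proof -
  have "dist (Fin z) (Fin w) \<le> 2 * dist z w" for z w
  proof -
    have "1 \<le> sqrt (1 + (cmod u)\<^sup>2)" for u by simp
    then have "1 * 1 \<le> sqrt (1 + (cmod z)\<^sup>2) * sqrt (1 + (cmod w)\<^sup>2)" by (intro mult_mono) auto
    then have "2 * cmod (z - w) / (sqrt (1 + (cmod z)\<^sup>2) * sqrt (1 + (cmod w)\<^sup>2)) \<le> 2 * cmod (z - w) / 1"
      by (intro divide_left_mono) auto
    then show ?thesis by (simp add: chordal_Fin_Fin dist_norm)
  qed
  then have "2-lipschitz_on A Fin" by (intro lipschitz_onI) auto
  then show ?thesis by (rule lipschitz_on_continuous_on)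
qed

text \<open>
  The function \<open>pr\<close> in the proof is the stereographic projection from the north pole, the continuous
  inverse of the embedding \<open>Fin\<close>.
\<close>

lemma open_Fin_image:
  assumes "open V"
  shows "open (Fin ` V)"
proof -
  define pr where "pr p = (1 / (1 - snd (stereo p))) *\<^sub>R fst (stereo p)" for p
  have pr_Fin: "pr (Fin z) = z" and ne: "snd (stereo (Fin z)) \<noteq> 1" for z
  proof -
    have p: "1 + (cmod z)\<^sup>2 \<noteq> 0" "(cmod z)\<^sup>2 + 1 \<noteq> 0" by (smt (verit) zero_le_power2)+
    have e: "1 - snd (stereo (Fin z)) = 2 / (1 + (cmod z)\<^sup>2)"
      using p by (simp add: field_simps)
    then have "pr (Fin z) = ((1 + (cmod z)\<^sup>2) / 2 * (2 / (1 + (cmod z)\<^sup>2))) *\<^sub>R z"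
      unfolding pr_def by simp
    also have "(1 + (cmod z)\<^sup>2) / 2 * (2 / (1 + (cmod z)\<^sup>2)) = 1"
      using p(1) by (simp only: times_divide_times_eq) (simp add: mult.commute)
    finally show "pr (Fin z) = z" by simp
    show "snd (stereo (Fin z)) \<noteq> 1" using e p by auto
  qed
  have fin: "p \<noteq> Infty \<longleftrightarrow> (\<exists>z. p = Fin z)" for p by (cases p) auto
  have "continuous_on UNIV stereo"
    by (rule lipschitz_on_continuous_on[of 1], rule lipschitz_onI) (auto simp: dist_extended_complex_def)
  then have st: "continuous_on (- {Infty}) stereo" using continuous_on_subset by blast
  have "continuous_on (- {Infty}) pr"
    unfolding pr_def
  proof (intro continuous_intros st)
    show "\<forall>p\<in>- {Infty}. 1 - snd (stereo p) \<noteq> 0"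
      using fin ne by (metis Compl_iff insertCI right_minus_eq)
  qed
  then have "open ((- {Infty}) \<inter> pr -` V)"
    using assms by (intro continuous_open_preimage) auto
  also have "(- {Infty}) \<inter> pr -` V = Fin ` V"
  proof (intro equalityI subsetI)
    fix p assume "p \<in> (- {Infty}) \<inter> pr -` V"
    then show "p \<in> Fin ` V" using pr_Fin by (cases p) auto
  qed (use pr_Fin in auto)
  finally show ?thesis .
qed

text \<open>
  A point of \<open>inside K\<close> outside \<open>W\<close> would be connected to \<open>\<infinity>\<close> in the complement of \<open>W\<close>, hence of \<open>K\<close>,
  in the sphere.  But there \<open>inside K\<close> is both open and closed.
\<close>

lemma inside_subset_without_holes:
  assumes W: "holes W = {}" and K: "compact K" "K \<subseteq> W"
  shows "inside K \<subseteq> W"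
proof
  fix z assume z: "z \<in> inside K"
  show "z \<in> W"
  proof (rule ccontr)
    assume "z \<notin> W"
    then have zW: "Fin z \<in> - (Fin ` W)" by auto
    define C where "C = connected_component_set (- (Fin ` W)) (Fin z)"
    have "C \<in> components (- (Fin ` W))" using zW by (auto simp: C_def components_def)
    then have inf: "Infty \<in> C" using W by (auto simp: holes_def)
    have CW: "C \<subseteq> - (Fin ` W)" and zC: "Fin z \<in> C" and conn: "connected C"
      using zW by (auto simp: C_def connected_component_subset dest: connected_component_in)
    have "open (Fin ` inside K)"
      using K(1) by (intro open_Fin_image open_inside compact_imp_closed)
    moreover have "open (- (Fin ` (K \<union> inside K)))"
      by (intro open_Compl compact_imp_closed compact_continuous_image continuous_on_Fin compact_Un_inside K)
    moreover have "C \<subseteq> Fin ` inside K \<union> - (Fin ` (K \<union> inside K))"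
      using CW K(2) by blast
    ultimately have "Fin ` inside K \<inter> C = {} \<or> - (Fin ` (K \<union> inside K)) \<inter> C = {}"
      using conn by (intro connectedD) auto
    then show False using z zC inf by auto
  qed
qed

section \<open>Escaping iterates and the Fatou set\<close>

text \<open>
  Locally uniform convergence of the iterates to \<open>\<infinity>\<close>, expressed with the modulus in place of the
  chordal metric.
\<close>

definition escapes :: "(complex \<Rightarrow> complex) \<Rightarrow> complex set \<Rightarrow> bool" where
  "escapes f V \<longleftrightarrow> (\<forall>K R. compact K \<longrightarrow> K \<subseteq> V \<longrightarrow>
     (\<forall>\<^sub>F n in sequentially. \<forall>z\<in>K. R < cmod ((f ^^ n) z)))"

lemma escapesD:
  "escapes f V \<Longrightarrow> compact K \<Longrightarrow> K \<subseteq> V \<Longrightarrow> \<forall>\<^sub>F n in sequentially. \<forall>z\<in>K. R < cmod ((f ^^ n) z)"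
  unfolding escapes_def by blast

lemma chordal_Infty_less_iff:
  assumes "R \<ge> 0"
  shows "dist (Fin z) Infty < 2 / sqrt (1 + R\<^sup>2) \<longleftrightarrow> R < cmod z"
proof -
  have p: "1 + (cmod z)\<^sup>2 > 0" "1 + R\<^sup>2 > 0" by (smt (verit) zero_le_power2)+
  have "dist (Fin z) Infty < 2 / sqrt (1 + R\<^sup>2) \<longleftrightarrow> sqrt (1 + R\<^sup>2) < sqrt (1 + (cmod z)\<^sup>2)"
    using p by (simp only: chordal_Fin_Infty) (simp add: divide_simps)
  also have "\<dots> \<longleftrightarrow> R\<^sup>2 < (cmod z)\<^sup>2" by simp
  also have "\<dots> \<longleftrightarrow> R < cmod z" using assms by (auto intro: power2_less_imp_less power_strict_mono)
  finally show ?thesis .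
qed

lemma tends_to_infinity_on_iff_escapes: "tends_to_infinity_on f V \<longleftrightarrow> escapes f V"
proof
  assume t: "tends_to_infinity_on f V"
  show "escapes f V"
    unfolding escapes_def
  proof (intro allI impI)
    fix K and R :: real assume "compact K" "K \<subseteq> V"
    then have u: "uniform_limit K (\<lambda>n. Fin \<circ> (f ^^ n)) (\<lambda>_. Infty) sequentially"
      using t unfolding tends_to_infinity_on_def converges_locally_uniformly_def by blast
    define S where "S = max R 0"
    have "1 + S\<^sup>2 > 0" by (smt (verit) zero_le_power2)
    then have "2 / sqrt (1 + S\<^sup>2) > 0" by simp
    then have "\<forall>\<^sub>F n in sequentially. \<forall>z\<in>K. dist ((Fin \<circ> (f ^^ n)) z) Infty < 2 / sqrt (1 + S\<^sup>2)"
      using u unfolding uniform_limit_iff by blast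
    then show "\<forall>\<^sub>F n in sequentially. \<forall>z\<in>K. R < cmod ((f ^^ n) z)"
    proof eventually_elim
      case (elim n)
      then show ?case using chordal_Infty_less_iff[of S] by (auto simp: S_def)
    qed
  qed
next
  assume e: "escapes f V"
  show "tends_to_infinity_on f V"
    unfolding tends_to_infinity_on_def converges_locally_uniformly_def uniform_limit_iff
  proof (intro allI impI)
    fix K and \<epsilon> :: real assume K: "compact K \<and> K \<subseteq> V" and \<epsilon>: "\<epsilon> > 0"
    have "\<forall>\<^sub>F n in sequentially. \<forall>z\<in>K. 2 / \<epsilon> < cmod ((f ^^ n) z)"
      using escapesD[OF e] K by blast
    then show "\<forall>\<^sub>F n in sequentially. \<forall>z\<in>K. dist ((Fin \<circ> (f ^^ n)) z) Infty < \<epsilon>"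
    proof eventually_elim
      case (elim n)
      show ?case
      proof
        fix z assume z: "z \<in> K"
        have "2 / \<epsilon> < sqrt (1 + (2 / \<epsilon>)\<^sup>2)" using \<epsilon> by (intro real_less_rsqrt) auto
        then have "2 / sqrt (1 + (2 / \<epsilon>)\<^sup>2) < \<epsilon>"
          using \<epsilon> by (smt (verit) divide_less_eq divide_pos_pos mult.commute pos_divide_less_eq)
        moreover have "dist (Fin ((f ^^ n) z)) Infty < 2 / sqrt (1 + (2 / \<epsilon>)\<^sup>2)"
          using elim z \<epsilon> by (subst chordal_Infty_less_iff) auto
        ultimately show "dist ((Fin \<circ> (f ^^ n)) z) Infty < \<epsilon>" by simp
      qed
    qed
  qed
qed

lemma open_fatou_set: "open (fatou_set f)"
proof (subst open_subopen, intro ballI)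
  fix z assume "z \<in> fatou_set f"
  then show "\<exists>T. open T \<and> z \<in> T \<and> T \<subseteq> fatou_set f" unfolding fatou_set_def by blast
qed

lemma uniform_limit_subsequence:
  assumes "uniform_limit K s h sequentially" "filterlim m sequentially sequentially"
  shows "uniform_limit K (\<lambda>j. s (m j)) h sequentially"
  using filterlim_compose[OF assms] by simp

text \<open>
  A sequence of iterates either takes one of them infinitely often, and then has a constant
  subsequence, or its exponents tend to infinity, and then it converges to \<open>\<infinity>\<close> itself.
\<close>

lemma escapes_subset_fatou_set:
  assumes V: "open V" and f: "continuous_on UNIV f" and esc: "escapes f V"
  shows "V \<subseteq> fatou_set f"
proof -
  have cont: "continuous_on UNIV (f ^^ n)" for n
  proof (induction n)
    case (Suc n)
    then show ?case using continuous_on_compose2[OF f Suc] by (simp add: o_def)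
  qed (simp add: continuous_on_id id_def)
  have "normal_family V {Fin \<circ> (f ^^ n) |n. n \<ge> 1}"
    unfolding normal_family_def
  proof (intro allI impI)
    fix s :: "nat \<Rightarrow> complex \<Rightarrow> extended_complex"
    assume "range s \<subseteq> {Fin \<circ> (f ^^ n) |n. n \<ge> 1}"
    then have "\<forall>j. \<exists>n. s j = Fin \<circ> (f ^^ n)" by blast
    then obtain m where m: "\<And>j. s j = Fin \<circ> (f ^^ m j)" by metis
    show "\<exists>r h. strict_mono r \<and> continuous_on V h \<and> converges_locally_uniformly V (s \<circ> r) h"
    proof (cases "\<exists>n. infinite {j. m j = n}")
      case True
      then obtain n where inf: "infinite {j. m j = n}" by blast
      define r where "r = enumerate {j. m j = n}"
      have "strict_mono r" unfolding r_def using inf by (rule strict_mono_enumerate)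
      moreover have "m (r i) = n" for i using enumerate_in_set[OF inf, of i] by (simp add: r_def)
      then have "s \<circ> r = (\<lambda>i. Fin \<circ> (f ^^ n))" by (auto simp: m fun_eq_iff)
      moreover have "continuous_on V (Fin \<circ> (f ^^ n))"
        using cont[of n] by (intro continuous_on_compose continuous_on_Fin) (rule continuous_on_subset, auto)
      ultimately show ?thesis
        by (intro exI[of _ r] exI[of _ "Fin \<circ> (f ^^ n)"])
          (auto simp: converges_locally_uniformly_def uniform_limit_iff)
    next
      case False
      have "filterlim m sequentially sequentially"
        unfolding filterlim_at_top
      proof
        fix N
        have "finite (\<Union>n<N. {j. m j = n})" using False by auto
        then have "finite {j. \<not> m j \<ge> N}" by (rule finite_subset[rotated]) auto
        then show "\<forall>\<^sub>F j in sequentially. N \<le> m j"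
          by (simp add: cofinite_eq_sequentially[symmetric] eventually_cofinite)
      qed
      moreover have "tends_to_infinity_on f V" using esc by (simp add: tends_to_infinity_on_iff_escapes)
      ultimately have "converges_locally_uniformly V (s \<circ> id) (\<lambda>_. Infty)"
        unfolding tends_to_infinity_on_def converges_locally_uniformly_def
        using uniform_limit_subsequence[where s = "\<lambda>n. Fin \<circ> (f ^^ n)" and m = m] by (simp add: m[abs_def])
      then show ?thesis
        by (intro exI[of _ id] exI[of _ "\<lambda>_. Infty"]) (auto simp: strict_mono_def)
    qed
  qed
  then show ?thesis unfolding fatou_set_def using V by blast
qed

lemma holomorphic_on_funpow:
  assumes "f holomorphic_on UNIV"
  shows "(f ^^ n) holomorphic_on UNIV"
proof (induction n)
  case 0 then show ?case by (simp add: holomorphic_on_id)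
next
  case (Suc n)
  then show ?case
    using holomorphic_on_compose_gen[OF Suc assms] by (simp add: o_def)
qed

section \<open>Harnack's inequality for escaping iterates\<close>

text \<open>
  Harnack's inequality for the positive harmonic function \<open>ln \<bar>F\<bar>\<close>, the real part of a logarithm \<open>g\<close>
  of \<open>F\<close>.  The Cayley transform that sends \<open>g a\<close> to \<open>0\<close> maps the right half-plane to the unit disc, and
  the Schwarz lemma applies.
\<close>

lemma Harnack_disc:
  assumes F: "F holomorphic_on ball a r" and gt1: "\<And>z. z \<in> ball a r \<Longrightarrow> 1 < cmod (F z)"
    and z: "dist a z < r / 2"
  shows "ln (cmod (F z)) \<le> 3 * ln (cmod (F a))" "ln (cmod (F a)) \<le> 3 * ln (cmod (F z))"
proof -
  have r: "r > 0" using z zero_le_dist[of a z] by linarith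
  have nz: "\<And>z. z \<in> ball a r \<Longrightarrow> F z \<noteq> 0" using gt1 by force
  obtain g where g: "g holomorphic_on ball a r" "\<And>z. z \<in> ball a r \<Longrightarrow> F z = exp (g z)"
    using contractible_imp_holomorphic_log[OF F convex_imp_contractible[OF convex_ball] nz] by blast
  have Re: "ln (cmod (F w)) = Re (g w)" "Re (g w) > 0" if "w \<in> ball a r" for w
  proof -
    show 1: "ln (cmod (F w)) = Re (g w)" using g(2)[OF that] by simp
    show "Re (g w) > 0" using gt1[OF that] 1 ln_gt_zero by metis
  qed
  have ar: "a \<in> ball a r" using r by simp
  define \<phi> where "\<phi> w = (g (a + of_real r * w) - g a) / (g (a + of_real r * w) + cnj (g a))" for w
  have inb: "a + of_real r * w \<in> ball a r" if "cmod w < 1" for w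
    using that r by (simp add: dist_norm norm_mult)
  have nzd: "g (a + of_real r * w) + cnj (g a) \<noteq> 0" if "cmod w < 1" for w
  proof -
    have "Re (g (a + of_real r * w) + cnj (g a)) > 0" using Re(2)[OF inb[OF that]] Re(2)[OF ar] by simp
    then show ?thesis by (metis less_irrefl zero_complex.sel(1))
  qed
  have holg: "(\<lambda>w. g (a + of_real r * w)) holomorphic_on ball 0 1"
    using inb by (intro holomorphic_on_compose_gen[OF _ g(1), unfolded o_def] holomorphic_intros) auto
  have "\<phi> holomorphic_on ball 0 1"
    unfolding \<phi>_def using nzd by (intro holomorphic_intros holg) auto
  moreover have "\<phi> 0 = 0" by (simp add: \<phi>_def)
  moreover have "cmod (\<phi> w) < 1" if w: "cmod w < 1" for w
  proof -
    define u where "u = g (a + of_real r * w)"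
    have "Re u > 0" "Re (g a) > 0" using Re(2)[OF inb[OF w]] Re(2)[OF ar] by (auto simp: u_def)
    then have "Re u * Re (g a) > 0" by simp
    then have "(cmod (u - g a))\<^sup>2 < (cmod (u + cnj (g a)))\<^sup>2"
      unfolding cmod_power2 by (simp add: power2_eq_square algebra_simps)
    then have "cmod (u - g a) < cmod (u + cnj (g a))" by (rule power_less_imp_less_base) simp
    then show ?thesis using nzd[OF w] by (simp add: \<phi>_def u_def[symmetric] norm_divide)
  qed
  ultimately have Schw: "cmod (\<phi> w) \<le> cmod w" if "cmod w < 1" for w
    using Schwarz_Lemma(1)[of \<phi> w] that by blast
  define w where "w = (z - a) / of_real r"
  have w: "cmod w < 1/2" using z r by (simp add: w_def norm_divide dist_norm norm_minus_commute divide_simps)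
  have zw: "a + of_real r * w = z" using r by (simp add: w_def)
  define x where "x = Re (g z)"
  define b where "b = Re (g a)"
  define v where "v = Im (g z) - Im (g a)"
  have zr: "z \<in> ball a r" using z r by simp
  have pos: "x > 0" "b > 0" using Re(2)[OF zr] Re(2)[OF ar] by (auto simp: x_def b_def)
  have "cmod (\<phi> w) \<le> 1/2" using Schw[of w] w by simp
  then have "2 * cmod (g z - g a) \<le> cmod (g z + cnj (g a))"
    using nzd[of w] w by (simp add: \<phi>_def zw norm_divide divide_simps)
  then have "(2 * cmod (g z - g a))\<^sup>2 \<le> (cmod (g z + cnj (g a)))\<^sup>2" by (rule power_mono) simp
  then have le: "4 * ((x - b)\<^sup>2 + v\<^sup>2) \<le> (x + b)\<^sup>2 + v\<^sup>2"
    by (simp add: power_mult_distrib cmod_power2 x_def b_def v_def)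
  have "4 * A \<le> B" if "4 * (A + C) \<le> B + C" "C \<ge> 0" for A B C :: real
    using that unfolding distrib_left by linarith
  then have "4 * (x - b)\<^sup>2 \<le> (x + b)\<^sup>2" using le zero_le_power2 by blast
  then have "(2 * (x - b))\<^sup>2 \<le> (x + b)\<^sup>2" by (simp only: power_mult_distrib) simp
  then have "\<bar>2 * (x - b)\<bar> \<le> \<bar>x + b\<bar>" by (simp add: abs_le_square_iff)
  then have "2 * x - 2 * b \<le> x + b" "- (2 * x - 2 * b) \<le> x + b"
    using pos unfolding right_diff_distrib by (simp_all add: abs_le_iff)
  then have "x \<le> 3 * b" "b \<le> 3 * x" by linarith+
  then show "ln (cmod (F z)) \<le> 3 * ln (cmod (F a))" "ln (cmod (F a)) \<le> 3 * ln (cmod (F z))"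
    using Re(1)[OF zr] Re(1)[OF ar] by (auto simp: x_def b_def)
qed

text \<open>
  Since the iterates escape, \<open>ln \<bar>f\<^sup>n\<bar>\<close> is eventually positive and harmonic near each point.  The local
  inequalities are chained along the connected set \<open>G\<close>; the constant does not depend on \<open>n\<close>.
\<close>

lemma Harnack_iterates:
  assumes f: "f holomorphic_on UNIV" and G: "open G" "connected G" and esc: "escapes f G"
    and K: "compact K" "K \<subseteq> G"
  obtains C where "C > 0" "\<forall>\<^sub>F n in sequentially. \<forall>z\<in>K. \<forall>w\<in>K. ln (cmod ((f ^^ n) z)) \<le> C * ln (cmod ((f ^^ n) w))"
proof -
  define L where "L n z = ln (cmod ((f ^^ n) z))" for n z
  have loc: "\<exists>r>0. ball a r \<subseteq> G \<and> (\<forall>\<^sub>F n in sequentially. \<forall>z\<in>ball a r. L n z \<le> 3 * L n a \<and> L n a \<le> 3 * L n z)"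
    if a: "a \<in> G" for a
  proof -
    obtain r where r: "r > 0" "cball a r \<subseteq> G" using G(1) a open_contains_cball by blast
    show ?thesis
    proof (intro exI[of _ "r/2"] conjI)
      show "r / 2 > 0" using r by simp
      show "ball a (r/2) \<subseteq> G" using r by force
      have "\<forall>\<^sub>F n in sequentially. \<forall>z\<in>cball a r. 1 < cmod ((f ^^ n) z)"
        using r by (intro escapesD[OF esc]) auto
      then show "\<forall>\<^sub>F n in sequentially. \<forall>z\<in>ball a (r/2). L n z \<le> 3 * L n a \<and> L n a \<le> 3 * L n z"
      proof eventually_elim
        case (elim n)
        show ?case
        proof
          fix z assume "z \<in> ball a (r/2)"
          then have z: "dist a z < r / 2" by simp
          have h: "(f ^^ n) holomorphic_on ball a r"
            using holomorphic_on_subset[OF holomorphic_on_funpow[OF f]] by blast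
          show "L n z \<le> 3 * L n a \<and> L n a \<le> 3 * L n z"
            unfolding L_def using Harnack_disc[OF h _ z] elim by simp
        qed
      qed
    qed
  qed
  \<comment> \<open>Two points are comparable if the values of \<open>L n\<close> there differ by a bounded factor for all large
    \<open>n\<close>.  This is an equivalence relation with open classes.\<close>
  define ev where "ev C a b \<longleftrightarrow> (\<forall>\<^sub>F n in sequentially. L n a \<le> C * L n b \<and> L n b \<le> C * L n a)" for C a b
  define cmp where "cmp a b \<longleftrightarrow> (\<exists>C>0. ev C a b)" for a b
  have cmp_trans: "cmp a c" if ab: "cmp a b" and bc: "cmp b c" for a b c
  proof -
    obtain C D where C: "C > 0" "ev C a b" and D: "D > 0" "ev D b c"
      using ab bc unfolding cmp_def by blast
    have "ev (C * D) a c"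
      using C(2) D(2) unfolding ev_def
    proof eventually_elim
      case (elim n)
      then have "C * L n b \<le> C * (D * L n c)" "D * L n b \<le> D * (C * L n a)"
        using C(1) D(1) by (auto intro: mult_left_mono)
      with elim show ?case by (simp add: mult.assoc mult.left_commute)
    qed
    then show ?thesis unfolding cmp_def using C D by (intro exI[of _ "C * D"]) auto
  qed
  have cmp_sym: "cmp b a" if "cmp a b" for a b
    using that unfolding cmp_def ev_def by (simp add: conj_commute)
  have cmp_all: "cmp a b" if "a \<in> G" "b \<in> G" for a b
  proof (rule connected_equivalence_relation[OF G(2) that, where R = cmp])
    fix a assume a: "a \<in> G"
    obtain r where r: "r > 0" "ball a r \<subseteq> G"
      "\<forall>\<^sub>F n in sequentially. \<forall>z\<in>ball a r. L n z \<le> 3 * L n a \<and> L n a \<le> 3 * L n z"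
      using loc[OF a] by blast
    have "cmp a x" if "x \<in> ball a r" for x
      unfolding cmp_def ev_def
    proof (intro exI conjI)
      show "\<forall>\<^sub>F n in sequentially. L n a \<le> 3 * L n x \<and> L n x \<le> 3 * L n a"
        using r(3) by eventually_elim (use that in auto)
    qed auto
    then show "\<exists>T. openin (top_of_set G) T \<and> a \<in> T \<and> (\<forall>x\<in>T. cmp a x)"
      using r by (intro exI[of _ "ball a r"]) (auto intro: open_subset)
  qed (use cmp_trans cmp_sym in blast)+
  show ?thesis
  proof (cases "K = {}")
    case True
    then show ?thesis using that[of 1] by simp
  next
    case False
    then obtain a0 where a0: "a0 \<in> K" "a0 \<in> G" using K by blast
    have "\<forall>a\<in>K. \<exists>T D. open T \<and> a \<in> T \<and> D > 0 \<and>
        (\<forall>\<^sub>F n in sequentially. \<forall>z\<in>T. L n z \<le> D * L n a0 \<and> L n a0 \<le> D * L n z)"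
    proof
      fix a assume "a \<in> K"
      then have a: "a \<in> G" using K by blast
      obtain r where r: "r > 0"
        "\<forall>\<^sub>F n in sequentially. \<forall>z\<in>ball a r. L n z \<le> 3 * L n a \<and> L n a \<le> 3 * L n z"
        using loc[OF a] by blast
      obtain C where C: "C > 0" "\<forall>\<^sub>F n in sequentially. L n a \<le> C * L n a0 \<and> L n a0 \<le> C * L n a"
        using cmp_all[OF a a0(2)] unfolding cmp_def ev_def by blast
      have "\<forall>\<^sub>F n in sequentially. \<forall>z\<in>ball a r. L n z \<le> (3 * C) * L n a0 \<and> L n a0 \<le> (3 * C) * L n z"
        using r(2) C(2)
      proof eventually_elim
        case (elim n)
        show ?case
        proof
          fix z assume "z \<in> ball a r"
          then have z: "L n z \<le> 3 * L n a" "L n a \<le> 3 * L n z" using elim by auto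
          then have "C * L n a \<le> C * (3 * L n z)" using C(1) by (intro mult_left_mono) auto
          then show "L n z \<le> (3 * C) * L n a0 \<and> L n a0 \<le> (3 * C) * L n z" using z elim by auto
        qed
      qed
      then show "\<exists>T D. open T \<and> a \<in> T \<and> D > 0 \<and>
        (\<forall>\<^sub>F n in sequentially. \<forall>z\<in>T. L n z \<le> D * L n a0 \<and> L n a0 \<le> D * L n z)"
        using r C by (intro exI[of _ "ball a r"] exI[of _ "3 * C"]) auto
    qed
    then have "\<exists>T. \<forall>a\<in>K. \<exists>D. open (T a) \<and> a \<in> T a \<and> D > 0 \<and>
        (\<forall>\<^sub>F n in sequentially. \<forall>z\<in>T a. L n z \<le> D * L n a0 \<and> L n a0 \<le> D * L n z)"
      by (rule bchoice)
    then obtain T where "\<forall>a\<in>K. \<exists>D. open (T a) \<and> a \<in> T a \<and> D > 0 \<and>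
        (\<forall>\<^sub>F n in sequentially. \<forall>z\<in>T a. L n z \<le> D * L n a0 \<and> L n a0 \<le> D * L n z)" ..
    then have "\<exists>D. \<forall>a\<in>K. open (T a) \<and> a \<in> T a \<and> D a > 0 \<and>
        (\<forall>\<^sub>F n in sequentially. \<forall>z\<in>T a. L n z \<le> D a * L n a0 \<and> L n a0 \<le> D a * L n z)"
      by (rule bchoice)
    then obtain D where TD: "\<forall>a\<in>K. open (T a) \<and> a \<in> T a \<and> D a > 0 \<and>
        (\<forall>\<^sub>F n in sequentially. \<forall>z\<in>T a. L n z \<le> D a * L n a0 \<and> L n a0 \<le> D a * L n z)"
 ..
    have "K \<subseteq> (\<Union>a\<in>K. T a)" using TD by blast
    then obtain A where A: "A \<subseteq> K" "finite A" "K \<subseteq> (\<Union>a\<in>A. T a)"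
      using compactE_image[OF K(1), of K T] TD by blast
    \<comment> \<open>A constant that is at least every \<open>D a\<close> and positive even if \<open>A\<close> is empty.\<close>
    define E where "E = (\<Sum>a\<in>A. D a) + 1"
    have DE: "D a \<le> E" if "a \<in> A" for a
    proof -
      have "D a \<le> (\<Sum>a\<in>A. D a)"
        using that A TD by (intro member_le_sum) (auto intro: less_imp_le)
      then show ?thesis by (simp add: E_def)
    qed
    have "(\<Sum>a\<in>A. D a) \<ge> 0" using A TD by (intro sum_nonneg) (auto intro: less_imp_le)
    then have E: "E > 0" by (simp add: E_def)
    have all: "\<forall>\<^sub>F n in sequentially. \<forall>a\<in>A. \<forall>z\<in>T a. L n z \<le> D a * L n a0 \<and> L n a0 \<le> D a * L n z"
      using A TD by (intro eventually_ball_finite) auto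
    have "\<forall>\<^sub>F n in sequentially. \<forall>z\<in>K. 1 < cmod ((f ^^ n) z)"
      using K by (intro escapesD[OF esc]) auto
    with all have "\<forall>\<^sub>F n in sequentially. \<forall>z\<in>K. \<forall>w\<in>K. L n z \<le> (E * E) * L n w"
    proof eventually_elim
      case (elim n)
      have pos: "L n z \<ge> 0" if "z \<in> K" for z using elim that by (auto simp: L_def)
      have *: "L n z \<le> E * L n a0 \<and> L n a0 \<le> E * L n z" if z: "z \<in> K" for z
      proof -
        obtain a where a: "a \<in> A" "z \<in> T a" using z A(3) by blast
        then have "L n z \<le> D a * L n a0" "L n a0 \<le> D a * L n z" using elim by auto
        moreover have "D a * L n a0 \<le> E * L n a0" "D a * L n z \<le> E * L n z"
          using DE[OF a(1)] pos z a0 by (auto intro: mult_right_mono)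
        ultimately show ?thesis by linarith
      qed
      show ?case
      proof (intro ballI)
        fix z w assume zw: "z \<in> K" "w \<in> K"
        have "L n z \<le> E * L n a0" using * zw by blast
        also have "\<dots> \<le> E * (E * L n w)" using * zw E by (intro mult_left_mono) auto
        finally show "L n z \<le> (E * E) * L n w" by (simp add: mult.assoc)
      qed
    qed
    then show ?thesis using that[of "E * E"] E by (simp add: L_def)
  qed
qed

text \<open>
  Cauchy's estimates need the bound only for arbitrarily large discs, not for all of them.
\<close>

lemma Liouville_polynomial_along_discs:
  assumes f: "f holomorphic_on UNIV"
    and bd: "\<And>R0. \<exists>R\<ge>R0. \<forall>z\<in>ball 0 R. cmod (f z) \<le> R ^ k"
  shows "\<exists>p :: complex poly. \<forall>z. f z = poly p z"
proof -
  have zero: "(deriv ^^ n) f 0 = 0" if n: "n > k" for n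
  proof (rule ccontr)
    assume ne: "(deriv ^^ n) f 0 \<noteq> 0"
    define c where "c = cmod ((deriv ^^ n) f 0)"
    have c: "c > 0" using ne by (simp add: c_def)
    \<comment> \<open>Cauchy's estimate on the disc of radius \<open>R/2\<close> gives \<open>c * R \<le> fact n * 2 ^ n\<close>, which \<open>R \<ge> M\<close> violates.\<close>
    define M where "M = fact n * 2 ^ n / c + 2"
    have M: "M \<ge> 2" using c by (simp add: M_def)
    obtain R where R: "R \<ge> M" "\<forall>z\<in>ball 0 R. cmod (f z) \<le> R ^ k" using bd by blast
    have Rp: "R \<ge> 2" using R M by simp
    have "c \<le> fact n * (R ^ k) / (R / 2) ^ n"
      unfolding c_def
    proof (rule Cauchy_inequality)
      show "f holomorphic_on ball 0 (R/2)" using f holomorphic_on_subset by blast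
      show "continuous_on (cball 0 (R/2)) f"
        using f holomorphic_on_imp_continuous_on continuous_on_subset by blast
      show "\<And>x. cmod (0 - x) = R / 2 \<Longrightarrow> cmod (f x) \<le> R ^ k" using R Rp by auto
    qed (use Rp in auto)
    also have "\<dots> = fact n * 2 ^ n * (R ^ k / R ^ n)" by (simp add: power_divide)
    also have "R ^ k / R ^ n \<le> 1 / R"
    proof -
      have "R ^ k * R \<le> R ^ n" using Rp n by (simp only: power_Suc2[symmetric]) (intro power_increasing, auto)
      then show ?thesis using Rp by (simp add: divide_simps)
    qed
    then have "fact n * 2 ^ n * (R ^ k / R ^ n) \<le> fact n * 2 ^ n * (1 / R)"
      by (intro mult_left_mono) auto
    finally have "c * R \<le> fact n * 2 ^ n" using Rp by (simp add: divide_simps)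
    moreover have "c * R \<ge> c * M" using R c by simp
    moreover have "c * M = fact n * 2 ^ n + 2 * c" using c by (simp add: M_def field_simps)
    ultimately show False using c by linarith
  qed
  define p where "p = (\<Sum>n\<le>k. monom ((deriv ^^ n) f 0 / fact n) n)"
  show ?thesis
  proof (intro exI allI)
    fix z
    have "(\<lambda>n. (deriv ^^ n) f 0 / fact n * (z - 0) ^ n) sums f z"
    proof (rule holomorphic_power_series)
      show "f holomorphic_on ball 0 (cmod z + 1)" using f holomorphic_on_subset by blast
    qed auto
    moreover have "(\<lambda>n. (deriv ^^ n) f 0 / fact n * (z - 0) ^ n) sums (\<Sum>n\<le>k. (deriv ^^ n) f 0 / fact n * (z - 0) ^ n)"
      by (rule sums_finite) (auto simp: zero not_le)
    ultimately have "f z = (\<Sum>n\<le>k. (deriv ^^ n) f 0 / fact n * (z - 0) ^ n)"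
      using sums_unique2 by blast
    then show "f z = poly p z" by (simp add: p_def poly_sum poly_monom)
  qed
qed

section \<open>Invariant escaping components\<close>

lemma minimum_modulus_frontier:
  assumes g: "g holomorphic_on UNIV" and V: "open V" "bounded V" and m: "m > 0"
    and fr: "\<And>z. z \<in> frontier V \<Longrightarrow> m \<le> cmod (g z)" and nz: "\<And>z. z \<in> V \<Longrightarrow> g z \<noteq> 0" and z: "z \<in> V"
  shows "m \<le> cmod (g z)"
proof -
  have nz': "g w \<noteq> 0" if "w \<in> closure V" for w
    using that nz fr[of w] m V(1) by (cases "w \<in> V") (auto simp: frontier_def interior_open)
  have "cmod (1 / g z) \<le> 1 / m"
  proof (rule maximum_modulus_frontier[where f = "\<lambda>z. 1 / g z" and S = V])
    show "(\<lambda>z. 1 / g z) holomorphic_on interior V"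
      using nz V(1) by (intro holomorphic_intros holomorphic_on_subset[OF g]) (auto simp: interior_open)
    have "continuous_on (closure V) g"
      using holomorphic_on_imp_continuous_on[OF g] continuous_on_subset by blast
    then show "continuous_on (closure V) (\<lambda>z. 1 / g z)"
      using nz' by (intro continuous_intros) auto
    show "cmod (1 / g w) \<le> 1 / m" if "w \<in> frontier V" for w
      using fr[OF that] m by (simp add: norm_divide frac_le)
  qed (use V z in auto)
  then show ?thesis using m nz[OF z] by (simp add: norm_divide divide_simps)
qed

text \<open>
  Baker's argument.  If infinitely many iterates have zeros in the bounded component \<open>V\<close> of the
  complement of \<open>K\<close>, then \<open>f\<^sup>n(V)\<close> contains the disc about \<open>0\<close> of radius half the minimum \<open>R\<close> of \<open>\<bar>f\<^sup>n\<bar>\<close>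
  on \<open>K\<close>.  On this disc \<open>f\<close> is bounded by the values of \<open>f\<^sup>n\<^sup>+\<^sup>1\<close> on \<open>V\<close>, thus by those on \<open>K\<close>, which are
  values of \<open>f\<^sup>n\<close> on \<open>f(K) \<subseteq> G\<close>.  Harnack's inequality on \<open>K \<union> f(K)\<close> compares them with \<open>R\<close>.
\<close>

lemma invariant_escaping_component_fills:
  assumes f: "transcendental_entire f" and G: "fatou_component f G" "f ` G \<subseteq> G" and esc: "escapes f G"
    and K: "compact K" "K \<subseteq> G"
  shows "inside K \<subseteq> G"
proof
  fix z0 assume z0: "z0 \<in> inside K"
  have hol: "f holomorphic_on UNIV" using f by (simp add: transcendental_entire_def)
  have holn: "(f ^^ n) holomorphic_on UNIV" for n by (rule holomorphic_on_funpow[OF hol])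
  have contf: "continuous_on A f" for A
    using holomorphic_on_imp_continuous_on[OF hol] continuous_on_subset by blast
  have Gc: "G \<in> components (fatou_set f)" using G(1) by (simp add: fatou_component_def)
  have opG: "open G" and conG: "connected G"
    using open_components[OF open_fatou_set Gc] in_components_connected[OF Gc] by auto
  have cl: "closed K" using K(1) by (rule compact_imp_closed)
  define V where "V = connected_component_set (- K) z0"
  have zV: "z0 \<in> V" and bV: "bounded V" and Vc: "V \<in> components (- K)"
    using z0 by (auto simp: V_def inside_def components_def)
  have opV: "open V" using open_components[OF _ Vc] cl by (simp add: open_Compl)
  have frV: "frontier V \<subseteq> K" using frontier_of_components_closed_complement[OF cl Vc] .
  have "V \<noteq> UNIV" using bV not_bounded_UNIV by blast
  then have "frontier V \<noteq> {}" using zV by (auto simp: frontier_eq_empty)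
  then obtain x0 where x0: "x0 \<in> frontier V" "x0 \<in> K" using frV by blast
  have "V \<subseteq> G"
  proof (cases "\<forall>\<^sub>F n in sequentially. \<forall>v\<in>V. (f ^^ n) v \<noteq> 0")
    case True
    have "escapes f V"
      unfolding escapes_def
    proof (intro allI impI)
      fix L and R :: real assume L: "compact L" "L \<subseteq> V"
      have "\<forall>\<^sub>F n in sequentially. \<forall>z\<in>K. \<bar>R\<bar> + 1 < cmod ((f ^^ n) z)" by (rule escapesD[OF esc K])
      then show "\<forall>\<^sub>F n in sequentially. \<forall>z\<in>L. R < cmod ((f ^^ n) z)"
        using True
      proof eventually_elim
        case (elim n)
        have m: "\<bar>R\<bar> + 1 \<le> cmod ((f ^^ n) x)" if "x \<in> frontier V" for x
          using elim(1) frV that by (meson less_imp_le subsetD)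
        show ?case
        proof
          fix z assume "z \<in> L"
          then have z: "z \<in> V" using L(2) by blast
          have "\<bar>R\<bar> + 1 \<le> cmod ((f ^^ n) z)"
            by (rule minimum_modulus_frontier[OF holn opV bV _ m _ z]) (use elim(2) in auto)
          then show "R < cmod ((f ^^ n) z)" by linarith
        qed
      qed
    qed
    then have "V \<subseteq> fatou_set f" by (rule escapes_subset_fatou_set[OF opV contf])
    moreover have "G \<inter> V \<noteq> {}"
    proof -
      have "x0 \<in> closure V" "x0 \<in> G" using x0 K(2) by (auto simp: frontier_def)
      then show ?thesis using open_Int_closure_eq_empty[OF opG, of V] by blast
    qed
    ultimately show "V \<subseteq> G"
      using components_maximal[OF Gc] in_components_connected[OF Vc] by blast
  next
    case False
    define K' where "K' = K \<union> f ` K"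
    have K': "compact K'" "K' \<subseteq> G"
      unfolding K'_def using K G(2) by (auto intro!: compact_Un compact_continuous_image contf)
    obtain C where C: "C > 0"
      "\<forall>\<^sub>F n in sequentially. \<forall>z\<in>K'. \<forall>w\<in>K'. ln (cmod ((f ^^ n) z)) \<le> C * ln (cmod ((f ^^ n) w))"
      by (rule Harnack_iterates[OF hol opG conG esc K'])
    define k where "k = nat \<lceil>C\<rceil>"
    have k: "C \<le> real k" unfolding k_def by linarith
    have "\<exists>R\<ge>R0. \<forall>\<zeta>\<in>ball 0 R. cmod (f \<zeta>) \<le> R ^ (2 * k)" for R0
    proof -
      \<comment> \<open>Chosen such that \<open>R > S\<close> gives \<open>R/2 \<ge> R0\<close> and \<open>R \<le> (R/2)\<^sup>2\<close>; the latter turns a bound by \<open>R\<close> into one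
        by the radius \<open>R/2\<close>.\<close>
      define S where "S = 2 * (\<bar>R0\<bar> + 2)"
      have ev: "\<forall>\<^sub>F n in sequentially. \<forall>z\<in>K'. S < cmod ((f ^^ n) z)" by (rule escapesD[OF esc K'])
      have "\<exists>\<^sub>F n in sequentially. \<exists>v\<in>V. (f ^^ n) v = 0" using False by (simp add: frequently_def)
      from frequently_ex[OF frequently_eventually_frequently[OF this eventually_conj[OF C(2) ev]]]
      obtain n where n_all: "(\<exists>v\<in>V. (f ^^ n) v = 0) \<and>
          (\<forall>z\<in>K'. \<forall>w\<in>K'. ln (cmod ((f ^^ n) z)) \<le> C * ln (cmod ((f ^^ n) w))) \<and>
          (\<forall>z\<in>K'. S < cmod ((f ^^ n) z))" ..
      note n = conjunct1[OF n_all] conjunct1[OF conjunct2[OF n_all]] conjunct2[OF conjunct2[OF n_all]]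
      obtain v0 where v0: "v0 \<in> V" "(f ^^ n) v0 = 0" using n(1) by blast
      have "continuous_on K (\<lambda>z. cmod ((f ^^ n) z))"
        using holomorphic_on_imp_continuous_on[OF holn] continuous_on_subset by (intro continuous_intros) blast
      then obtain w where w: "w \<in> K" "\<And>z. z \<in> K \<Longrightarrow> cmod ((f ^^ n) w) \<le> cmod ((f ^^ n) z)"
        using continuous_attains_inf[OF K(1)] x0(2) by blast
      define R where "R = cmod ((f ^^ n) w)"
      have RS: "S < R" using n(3) w by (auto simp: R_def K'_def)
      have R4: "R > 4" using RS by (simp add: S_def)
      have fn1: "cmod ((f ^^ Suc n) v) \<le> R ^ k" if "v \<in> V" for v
      proof (rule maximum_modulus_frontier[OF _ _ bV _ that])
        show "(f ^^ Suc n) holomorphic_on interior V" using holn holomorphic_on_subset by blast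
        show "continuous_on (closure V) (f ^^ Suc n)"
          using holomorphic_on_imp_continuous_on[OF holn] continuous_on_subset by blast
        fix x assume "x \<in> frontier V"
        then have fx: "f x \<in> K'" "w \<in> K'" using frV w by (auto simp: K'_def)
        have pos: "cmod ((f ^^ n) (f x)) > 0" using n(3) fx(1) by (force simp: S_def)
        have "ln (cmod ((f ^^ n) (f x))) \<le> C * ln R" using n(2) fx by (auto simp: R_def)
        also have "\<dots> \<le> real k * ln R" using k R4 by (intro mult_right_mono) auto
        also have "\<dots> = ln (R ^ k)" using R4 by (simp add: ln_realpow)
        finally show "cmod ((f ^^ Suc n) x) \<le> R ^ k"
          using pos R4 by (simp add: funpow_swap1)
      qed
      \<comment> \<open>If the value \<open>\<zeta>\<close> were omitted, the minimum modulus principle for \<open>f\<^sup>n - \<zeta>\<close> would fail at the zero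
        \<open>v0\<close> of \<open>f\<^sup>n\<close>.\<close>
      have cover: "\<exists>v\<in>V. (f ^^ n) v = \<zeta>" if \<zeta>: "cmod \<zeta> < R / 2" for \<zeta>
      proof (rule ccontr)
        assume no: "\<not> ?thesis"
        have "R - cmod \<zeta> \<le> cmod ((f ^^ n) v0 - \<zeta>)"
        proof (rule minimum_modulus_frontier[where g = "\<lambda>z. (f ^^ n) z - \<zeta>", OF _ opV bV])
          show "(\<lambda>z. (f ^^ n) z - \<zeta>) holomorphic_on UNIV" by (intro holomorphic_intros holn)
          show "R - cmod \<zeta> > 0" using \<zeta> R4 by simp
          fix x assume "x \<in> frontier V"
          then have "R \<le> cmod ((f ^^ n) x)" using w frV by (auto simp: R_def)
          then show "R - cmod \<zeta> \<le> cmod ((f ^^ n) x - \<zeta>)"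
            using norm_triangle_ineq2[of "(f ^^ n) x" \<zeta>] by linarith
        qed (use no v0 in auto)
        then show False using \<zeta> v0 by simp
      qed
      show ?thesis
      proof (intro exI conjI ballI)
        show "R / 2 \<ge> R0" using RS by (simp add: S_def)
        fix \<zeta> :: complex assume "\<zeta> \<in> ball 0 (R / 2)"
        then obtain v where v: "v \<in> V" "(f ^^ n) v = \<zeta>" using cover by auto
        have "cmod (f \<zeta>) \<le> R ^ k" using fn1[OF v(1)] v(2) by simp
        also have "\<dots> \<le> ((R / 2)\<^sup>2) ^ k"
        proof (rule power_mono)
          show "R \<le> (R / 2)\<^sup>2" using R4 by (simp add: power2_eq_square)
        qed (use R4 in auto)
        finally show "cmod (f \<zeta>) \<le> (R / 2) ^ (2 * k)" by (simp add: power_mult)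
      qed
    qed
    then have "\<exists>p :: complex poly. \<forall>z. f z = poly p z"
      by (rule Liouville_polynomial_along_discs[OF hol])
    then show ?thesis using f by (simp add: transcendental_entire_def)
  qed
  then show "z0 \<in> G" using zV by blast
qed

section \<open>Wandering domains\<close>

lemma escapes_image:
  assumes f: "f holomorphic_on UNIV" and G: "open G" "inj_on (f ^^ k) G" and esc: "escapes f G"
  shows "escapes f ((f ^^ k) ` G)"
  unfolding escapes_def
proof (intro allI impI)
  fix L and R :: real assume L: "compact L" "L \<subseteq> (f ^^ k) ` G"
  have "(f ^^ k) holomorphic_on G" using holomorphic_on_funpow[OF f] holomorphic_on_subset by blast
  then obtain g where g: "g holomorphic_on ((f ^^ k) ` G)" "\<And>z. z \<in> G \<Longrightarrow> g ((f ^^ k) z) = z"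
    using holomorphic_has_inverse[OF _ G] by metis
  have "compact (g ` L)"
    using g(1) L holomorphic_on_imp_continuous_on continuous_on_subset by (intro compact_continuous_image) blast+
  moreover have "g ` L \<subseteq> G" using L(2) g(2) by auto
  ultimately have "\<forall>\<^sub>F n in sequentially. \<forall>z\<in>g ` L. R < cmod ((f ^^ n) z)" by (rule escapesD[OF esc])
  then have "\<forall>\<^sub>F n in sequentially. \<forall>z\<in>g ` L. R < cmod ((f ^^ (n + k)) z)"
    by (rule sequentially_offset)
  then show "\<forall>\<^sub>F n in sequentially. \<forall>z\<in>L. R < cmod ((f ^^ n) z)"
  proof eventually_elim
    case (elim n)
    show ?case
    proof
      fix z assume z: "z \<in> L"
      then obtain a where a: "a \<in> G" "z = (f ^^ k) a" using L(2) by blast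
      then have "a \<in> g ` L" using g(2)[OF a(1)] z by force
      then have "R < cmod ((f ^^ (n + k)) a)" using elim by blast
      then show "R < cmod ((f ^^ n) z)" using a(2) by (simp add: funpow_add)
    qed
  qed
qed

text \<open>
  Each \<open>f\<^sup>k(G)\<close> is open and connected, and the iterates escape on it, so it lies in the Fatou set and
  in a unique component.  For different \<open>k\<close> these components differ, as \<open>G\<close> is not preperiodic.
\<close>

lemma wandering_images_disjoint:
  assumes f: "f holomorphic_on UNIV" and G: "wandering_domain f G"
    and inj: "\<And>k. inj_on (f ^^ k) G" and esc: "escapes f G" and ij: "i \<noteq> j"
  shows "(f ^^ i) ` G \<inter> (f ^^ j) ` G = {}"
proof -
  have Gc: "G \<in> components (fatou_set f)" using G by (simp add: wandering_domain_def fatou_component_def)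
  have opG: "open G" and conG: "connected G" and neG: "G \<noteq> {}"
    using open_components[OF open_fatou_set Gc] in_components_connected[OF Gc] in_components_nonempty[OF Gc] by auto
  have comp: "image_component f G k \<in> components (fatou_set f) \<and> (f ^^ k) ` G \<subseteq> image_component f G k" for k
  proof -
    have hol: "(f ^^ k) holomorphic_on G" using holomorphic_on_funpow[OF f] holomorphic_on_subset by blast
    have op: "open ((f ^^ k) ` G)" using open_mapping_thm3[OF hol opG inj] .
    have con: "connected ((f ^^ k) ` G)"
      using holomorphic_on_imp_continuous_on[OF hol] conG by (rule connected_continuous_image)
    have sub: "(f ^^ k) ` G \<subseteq> fatou_set f"
      by (rule escapes_subset_fatou_set[OF op holomorphic_on_imp_continuous_on[OF f] escapes_image[OF f opG inj esc]])
    obtain C where C: "C \<in> components (fatou_set f)" "(f ^^ k) ` G \<subseteq> C"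
      using exists_component_superset[OF sub _ con] neG sub by blast
    have "\<exists>!C. fatou_component f C \<and> (f ^^ k) ` G \<subseteq> C"
    proof (rule ex1I[of _ C])
      show "fatou_component f C \<and> (f ^^ k) ` G \<subseteq> C" using C by (simp add: fatou_component_def)
      fix D assume "fatou_component f D \<and> (f ^^ k) ` G \<subseteq> D"
      then show "D = C"
        using C neG components_nonoverlap[of D "fatou_set f" C] unfolding fatou_component_def by blast
    qed
    from theI'[OF this] show ?thesis unfolding image_component_def fatou_component_def .
  qed
  have "image_component f G i \<noteq> image_component f G j"
    using G ij unfolding wandering_domain_def preperiodic_component_def by (metis linorder_neqE_nat)
  then have "image_component f G i \<inter> image_component f G j = {}"
    using components_nonoverlap comp by blast
  then show ?thesis using comp[of i] comp[of j] by blast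
qed

text \<open>
  Removing from a compact set the other open pieces leaves its part in one piece compact.
\<close>

lemma compact_in_disjoint_Union:
  fixes U :: "'i \<Rightarrow> complex set"
  assumes L: "compact L" "L \<subseteq> (\<Union>i\<in>I. U i)" and U: "\<And>i. i \<in> I \<Longrightarrow> open (U i)"
    "\<And>i j. i \<in> I \<Longrightarrow> j \<in> I \<Longrightarrow> i \<noteq> j \<Longrightarrow> U i \<inter> U j = {}"
  obtains F where "finite F" "F \<subseteq> I" "L = (\<Union>i\<in>F. L \<inter> U i)" "\<And>i. i \<in> F \<Longrightarrow> compact (L \<inter> U i)"
proof -
  obtain F where F: "F \<subseteq> I" "finite F" "L \<subseteq> (\<Union>i\<in>F. U i)"
    by (rule compactE_image[OF L(1) U(1) L(2)])
  have "compact (L \<inter> U i)" if i: "i \<in> F" for i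
  proof -
    have "L \<inter> U i = L - (\<Union>j\<in>F - {i}. U j)"
    proof (intro equalityI subsetI)
      fix x assume "x \<in> L \<inter> U i"
      then show "x \<in> L - (\<Union>j\<in>F - {i}. U j)" using U(2)[of i] i F(1) by fastforce
    qed (use F(3) in fastforce)
    moreover have "open (\<Union>j\<in>F - {i}. U j)" using U(1) F(1) by blast
    ultimately show ?thesis using L(1) by (simp add: compact_diff)
  qed
  moreover have "L = (\<Union>i\<in>F. L \<inter> U i)" using F(3) by blast
  ultimately show ?thesis by (intro that[OF F(2,1)])
qed

section \<open>Baire category for entire functions\<close>

lemma complex_rat_approx:
  assumes "e > 0"
  obtains a b :: rat where "cmod (z - Complex (of_rat a) (of_rat b)) < e"
proof -
  obtain a where a: "Re z - e/2 < of_rat a" "of_rat a < Re z"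
    using of_rat_dense[of "Re z - e/2" "Re z"] assms by auto
  obtain b where b: "Im z - e/2 < of_rat b" "of_rat b < Im z"
    using of_rat_dense[of "Im z - e/2" "Im z"] assms by auto
  have "cmod (z - Complex (of_rat a) (of_rat b)) \<le> \<bar>Re z - of_rat a\<bar> + \<bar>Im z - of_rat b\<bar>"
    using cmod_le[of "z - Complex (of_rat a) (of_rat b)"] by simp
  also have "\<dots> < e" using a b by linarith
  finally show ?thesis using that by blast
qed

text \<open>
  Polynomials whose coefficients have rational real and imaginary parts, indexed by a countable type.
\<close>

definition rational_poly :: "(rat \<times> rat) list \<Rightarrow> complex poly" where
  "rational_poly xs = Poly (map (\<lambda>(a, b). Complex (of_rat a) (of_rat b)) xs)"

lemma rational_poly_approx:
  assumes K: "compact K" and e: "e > 0"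
  shows "\<exists>xs. \<forall>z\<in>K. cmod (poly p z - poly (rational_poly xs) z) < e"
  using e
proof (induction p arbitrary: e rule: pCons_induct)
  case 0
  then show ?case by (intro exI[of _ "[]"]) (simp add: rational_poly_def)
next
  case (pCons c p)
  obtain M where M: "M > 0" "\<And>z. z \<in> K \<Longrightarrow> cmod z \<le> M"
    by (metis K compact_imp_bounded bounded_pos)
  obtain a b where ab: "cmod (c - Complex (of_rat a) (of_rat b)) < e / 2"
    using complex_rat_approx[of "e/2" c] pCons.prems by auto
  have "e / (2 * M) > 0" using pCons.prems M by simp
  then obtain xs where xs: "\<forall>z\<in>K. cmod (poly p z - poly (rational_poly xs) z) < e / (2 * M)"
    using pCons.IH by blast
  show ?case
  proof (intro exI[of _ "(a, b) # xs"] ballI)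
    fix z assume z: "z \<in> K"
    define q where "q = poly (rational_poly xs) z"
    have "poly (pCons c p) z - poly (rational_poly ((a, b) # xs)) z
        = (c - Complex (of_rat a) (of_rat b)) + z * (poly p z - q)"
      by (simp add: rational_poly_def q_def algebra_simps)
    then have "cmod (poly (pCons c p) z - poly (rational_poly ((a, b) # xs)) z)
        \<le> cmod (c - Complex (of_rat a) (of_rat b)) + cmod z * cmod (poly p z - q)"
      by (metis norm_triangle_ineq norm_mult)
    also have "cmod z * cmod (poly p z - q) \<le> M * (e / (2 * M))"
      using M z xs by (intro mult_mono) (auto simp: q_def intro: less_imp_le)
    also have "M * (e / (2 * M)) = e / 2" using M by simp
    finally show "cmod (poly (pCons c p) z - poly (rational_poly ((a, b) # xs)) z) < e"
      using ab by simp
  qed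
qed

lemma holo_functions_UNIV: "holo_functions UNIV = {g. g holomorphic_on UNIV}"
  by (auto simp: holo_functions_def extensional_def)

text \<open>
  The sets of all functions within \<open>e n\<close> of \<open>g n\<close> on the disc of radius \<open>R n\<close> play the role of nested
  closed balls.  The centres converge locally uniformly to a point common to all of them.
\<close>

lemma limit_of_nested_closed_balls:
  fixes g :: "nat \<Rightarrow> complex \<Rightarrow> complex" and R e :: "nat \<Rightarrow> real"
  assumes hol: "\<And>n. g n holomorphic_on UNIV"
    and e: "\<And>n. e n > 0" "e \<longlonglongrightarrow> 0" and R: "\<And>n. R n \<ge> R 0 + real n"
    and near: "\<And>m n z. n \<le> m \<Longrightarrow> cmod z \<le> R n \<Longrightarrow> cmod (g m z - g n z) \<le> e n"
  obtains h where "h holomorphic_on UNIV" "\<forall>n z. cmod z \<le> R n \<longrightarrow> cmod (h z - g n z) \<le> e n"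
proof -
  have big: "\<exists>N. \<forall>n\<ge>N. r \<le> R n" for r
  proof -
    obtain N :: nat where "r - R 0 \<le> real N" using real_arch_simple by blast
    then have "r \<le> R n" if "n \<ge> N" for n using R[of n] that by linarith
    then show ?thesis by blast
  qed
  have "Cauchy (\<lambda>n. g n z)" for z
  proof (rule metric_CauchyI)
    fix \<epsilon> :: real assume "\<epsilon> > 0"
    then have "\<forall>\<^sub>F n in sequentially. e n < \<epsilon> / 2" using e(2) by (intro order_tendstoD(2)) auto
    moreover have "\<forall>\<^sub>F n in sequentially. cmod z \<le> R n" using big[of "cmod z"] by (simp add: eventually_sequentially)
    ultimately have "\<forall>\<^sub>F n in sequentially. e n < \<epsilon> / 2 \<and> cmod z \<le> R n" by eventually_elim auto
    then obtain N where N: "e N < \<epsilon> / 2" "cmod z \<le> R N"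
      unfolding eventually_sequentially by blast
    show "\<exists>M. \<forall>m\<ge>M. \<forall>n\<ge>M. dist (g m z) (g n z) < \<epsilon>"
    proof (intro exI[of _ N] allI impI)
      fix m n assume mn: "N \<le> m" "N \<le> n"
      have "dist (g m z) (g N z) \<le> e N" "dist (g n z) (g N z) \<le> e N"
        using near[OF mn(1) N(2)] near[OF mn(2) N(2)] by (auto simp: dist_norm)
      then show "dist (g m z) (g n z) < \<epsilon>" using N(1) dist_triangle2[of "g m z" "g n z" "g N z"] by linarith
    qed
  qed
  then have "\<forall>z. \<exists>l. (\<lambda>n. g n z) \<longlonglongrightarrow> l" by (simp add: Cauchy_convergent_iff convergent_def)
  then obtain h where h: "\<And>z. (\<lambda>n. g n z) \<longlonglongrightarrow> h z" by metis
  have le: "cmod (h z - g n z) \<le> e n" if "cmod z \<le> R n" for n z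
  proof (rule Lim_norm_ubound)
    show "(\<lambda>m. g m z - g n z) \<longlonglongrightarrow> h z - g n z" by (intro tendsto_intros h)
    show "\<forall>\<^sub>F m in sequentially. cmod (g m z - g n z) \<le> e n"
      unfolding eventually_sequentially using near[OF _ that] by blast
  qed auto
  have "h holomorphic_on UNIV"
  proof (rule holomorphic_uniform_sequence[OF open_UNIV hol])
    fix x :: complex
    obtain N where N: "\<forall>n\<ge>N. cmod x + 1 \<le> R n" using big by blast
    have "uniform_limit (cball x 1) g h sequentially"
      unfolding uniform_limit_iff
    proof (intro allI impI)
      fix \<epsilon> :: real assume "\<epsilon> > 0"
      then have "\<forall>\<^sub>F n in sequentially. e n < \<epsilon>" using e(2) by (intro order_tendstoD(2)) auto
      then show "\<forall>\<^sub>F n in sequentially. \<forall>y\<in>cball x 1. dist (g n y) (h y) < \<epsilon>"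
        using eventually_ge_at_top[of N]
      proof eventually_elim
        case (elim n)
        show ?case
        proof
          fix y assume "y \<in> cball x 1"
          then have "cmod y \<le> cmod x + 1"
            using norm_triangle_ineq[of x "y - x"] by (simp add: dist_norm norm_minus_commute)
          then have "cmod (h y - g n y) \<le> e n" using N elim(2) by (intro le) force
          then show "dist (g n y) (h y) < \<epsilon>" using elim(1) by (simp add: dist_norm norm_minus_commute)
        qed
      qed
    qed
    then show "\<exists>d>0. cball x d \<subseteq> UNIV \<and> uniform_limit (cball x d) g h sequentially"
      by (intro exI[of _ 1]) auto
  qed
  then show ?thesis using le that by blast
qed

text \<open>
  Density in \<open>H(\<complex>)\<close>, with discs in place of general compact sets.
\<close>

definition dense_entire :: "(complex \<Rightarrow> complex) set \<Rightarrow> bool" where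
  "dense_entire S \<longleftrightarrow> (\<forall>g r e. g holomorphic_on UNIV \<longrightarrow> e > 0 \<longrightarrow>
     (\<exists>h\<in>S. \<forall>z. cmod z \<le> r \<longrightarrow> cmod (h z - g z) < e))"

lemma dense_entireD:
  assumes "dense_entire S" "g holomorphic_on UNIV" "e > 0"
  obtains h where "h \<in> S" "\<And>z. cmod z \<le> r \<Longrightarrow> cmod (h z - g z) < e"
  using assms unfolding dense_entire_def by blast

lemma dense_entire_imp_dense_in:
  assumes S: "S \<subseteq> {g. g holomorphic_on UNIV}" "dense_entire S"
  shows "dense_in (holo_space UNIV) S"
  unfolding dense_in_def
proof
  show sub: "S \<subseteq> topspace (holo_space UNIV)" using S(1) by (simp add: topspace_holo_space holo_functions_UNIV)
  show "holo_space UNIV closure_of S = topspace (holo_space UNIV)"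
  proof (intro equalityI closure_of_subset_topspace subsetI)
    fix g assume g: "g \<in> topspace (holo_space UNIV)"
    then have hol: "g holomorphic_on UNIV" by (simp add: topspace_holo_space holo_functions_UNIV)
    show "g \<in> holo_space UNIV closure_of S"
      unfolding in_closure_of
    proof (intro conjI g allI impI)
      fix T assume T: "g \<in> T \<and> openin (holo_space UNIV) T"
      then obtain K e where K: "compact K" "e > 0" "{h \<in> holo_functions UNIV. \<forall>z\<in>K. dist (h z) (g z) < e} \<subseteq> T"
        unfolding openin_holo_space by blast
      obtain r where r: "\<And>z. z \<in> K \<Longrightarrow> cmod z \<le> r" by (metis K(1) compact_imp_bounded bounded_iff)
      obtain h where h: "h \<in> S" "\<And>z. cmod z \<le> r \<Longrightarrow> cmod (h z - g z) < e"
        by (rule dense_entireD[OF S(2) hol K(2), of r]) (rule that; blast)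
      then have "h \<in> T" using K(3) S(1) r by (auto simp: holo_functions_UNIV dist_norm)
      then show "\<exists>y. y \<in> S \<and> y \<in> T" using h(1) by blast
    qed
  qed
qed

text \<open>
  The usual proof of Baire's theorem.  A closed ball is encoded as a triple of centre, radius of the
  disc, and error bound.
\<close>

lemma Baire_entire:
  fixes \<U> :: "nat \<Rightarrow> (complex \<Rightarrow> complex) set"
  assumes op: "\<And>n. openin (holo_space UNIV) (\<U> n)" and dn: "\<And>n. dense_entire (\<U> n)"
  shows "dense_entire (\<Inter>n. \<U> n)"
  unfolding dense_entire_def
proof (intro allI impI)
  fix g0 :: "complex \<Rightarrow> complex" and r0 e0 :: real
  assume g0: "g0 holomorphic_on UNIV" and e0: "e0 > 0"
  define B where "B = (\<lambda>(g, r, e). {h. h holomorphic_on UNIV \<and> (\<forall>z. cmod z \<le> r \<longrightarrow> cmod (h z - g z) \<le> e)})"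
  define good where "good = (\<lambda>(g :: complex \<Rightarrow> complex, r :: real, e :: real). g holomorphic_on UNIV \<and> e > 0)"
  define step where "step n s t \<longleftrightarrow> B t \<subseteq> \<U> n \<inter> B s \<and> fst (snd t) \<ge> fst (snd s) + 1 \<and> snd (snd t) \<le> snd (snd s) / 2"
    for n s t
  have ex: "\<exists>t. good t \<and> step n s t" if s: "good s" for n s
  proof -
    obtain g r e where s_eq: "s = (g, r, e)" by (cases s) auto
    have g: "g holomorphic_on UNIV" and e: "e > 0" using s by (auto simp: s_eq good_def)
    have e2: "e/2 > 0" using e by simp
    obtain g' where g': "g' \<in> \<U> n" "\<And>z. cmod z \<le> r \<Longrightarrow> cmod (g' z - g z) < e/2"
      by (rule dense_entireD[OF dn[of n] g e2, of r]) (rule that; blast)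
    obtain K d where K: "compact K" "d > 0" "{h \<in> holo_functions UNIV. \<forall>z\<in>K. dist (h z) (g' z) < d} \<subseteq> \<U> n"
      using op[of n] g'(1) unfolding openin_holo_space by blast
    have hol': "g' holomorphic_on UNIV" using op[of n] g'(1) unfolding openin_holo_space holo_functions_UNIV by blast
    obtain \<rho> where \<rho>: "\<And>z. z \<in> K \<Longrightarrow> cmod z \<le> \<rho>" by (metis K(1) compact_imp_bounded bounded_iff)
    define t where "t = (g', max (r + 1) \<rho>, min (d/2) (e/2))"
    have "good t" using hol' e K(2) by (simp add: t_def good_def)
    moreover have "B t \<subseteq> \<U> n \<inter> B s"
    proof
      fix h assume h: "h \<in> B t"
      then have hh: "h holomorphic_on UNIV" "\<And>z. cmod z \<le> max (r + 1) \<rho> \<Longrightarrow> cmod (h z - g' z) \<le> min (d/2) (e/2)"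
        by (auto simp: B_def t_def)
      have "h \<in> \<U> n"
      proof (rule subsetD[OF K(3)], simp add: holo_functions_UNIV hh(1), intro ballI)
        fix z assume "z \<in> K"
        then have "cmod (h z - g' z) \<le> d/2" using hh(2)[of z] \<rho>[of z] by auto
        then show "dist (h z) (g' z) < d" using K(2) by (simp add: dist_norm)
      qed
      moreover have "cmod (h z - g z) \<le> e" if z: "cmod z \<le> r" for z
      proof -
        have "cmod (h z - g' z) \<le> e/2" using hh(2)[of z] z by auto
        then show ?thesis using g'(2)[OF z] norm_triangle_ineq[of "h z - g' z" "g' z - g z"] by simp
      qed
      ultimately show "h \<in> \<U> n \<inter> B s" using hh(1) by (auto simp: B_def s_eq)
    qed
    ultimately show ?thesis by (intro exI[of _ t]) (auto simp: step_def t_def s_eq)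
  qed
  have "good (g0, r0, e0/2)" using g0 e0 by (simp add: good_def)
  then have "\<exists>s. \<forall>n. (good (s n) \<and> (n = 0 \<longrightarrow> s n = (g0, r0, e0/2))) \<and> step n (s n) (s (Suc n))"
    using ex by (intro dependent_nat_choice) auto
  then obtain s where s: "\<And>n. good (s n)" "s 0 = (g0, r0, e0/2)" "\<And>n. step n (s n) (s (Suc n))"
    by blast
  define g where "g n = fst (s n)" for n
  define R where "R n = fst (snd (s n))" for n
  define e where "e n = snd (snd (s n))" for n
  have s_eq: "s n = (g n, R n, e n)" for n by (simp add: g_def R_def e_def)
  have gd: "g n holomorphic_on UNIV" "e n > 0" for n using s(1)[of n] by (auto simp: s_eq good_def)
  have st: "B (s (Suc n)) \<subseteq> \<U> n" "B (s (Suc n)) \<subseteq> B (s n)" "R (Suc n) \<ge> R n + 1" "e (Suc n) \<le> e n / 2" for n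
    using s(3)[of n] by (auto simp: step_def R_def e_def)
  have Bmono: "B (s m) \<subseteq> B (s n)" if "n \<le> m" for m n
    using lift_Suc_antimono_le[of "\<lambda>n. B (s n)", OF st(2) that] .
  have R: "R n \<ge> R 0 + real n" for n
  proof (induction n)
    case (Suc n) then show ?case using st(3)[of n] by simp
  qed simp
  have e_le: "e n \<le> e 0 * (1/2) ^ n" for n
  proof (induction n)
    case (Suc n) then show ?case using st(4)[of n] by simp
  qed simp
  have "(\<lambda>n. e 0 * (1/2) ^ n) \<longlonglongrightarrow> e 0 * 0"
    by (intro tendsto_intros LIMSEQ_power_zero) auto
  then have "e \<longlonglongrightarrow> 0"
    using gd(2) e_le by (intro tendsto_sandwich[of "\<lambda>_. 0" e sequentially "\<lambda>n. e 0 * (1/2) ^ n"])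
      (auto intro!: always_eventually less_imp_le)
  moreover have "cmod (g m z - g n z) \<le> e n" if "n \<le> m" "cmod z \<le> R n" for m n z
  proof -
    have "g m \<in> B (s m)" using gd[of m] by (auto simp: B_def s_eq intro: less_imp_le)
    then show ?thesis using Bmono[OF that(1)] that(2) by (auto simp: B_def s_eq)
  qed
  ultimately obtain h where h: "h holomorphic_on UNIV" "\<forall>n z. cmod z \<le> R n \<longrightarrow> cmod (h z - g n z) \<le> e n"
    by (rule limit_of_nested_closed_balls[OF gd(1) gd(2) _ R])
  have hB: "h \<in> B (s n)" for n using h by (auto simp: B_def s_eq)
  show "\<exists>h\<in>\<Inter>n. \<U> n. \<forall>z. cmod z \<le> r0 \<longrightarrow> cmod (h z - g0 z) < e0"
  proof (intro bexI[of _ h] allI impI)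
    show "h \<in> (\<Inter>n. \<U> n)" using hB st(1) by blast
    fix z assume "cmod z \<le> r0"
    then have "cmod (h z - g0 z) \<le> e0 / 2" using hB[of 0] by (auto simp: B_def s(2))
    then show "cmod (h z - g0 z) < e0" using e0 by simp
  qed
qed

lemma comeager_Inter_entire:
  fixes \<U> :: "nat \<Rightarrow> (complex \<Rightarrow> complex) set"
  assumes op: "\<And>n. openin (holo_space UNIV) (\<U> n)" and dn: "\<And>n. dense_entire (\<U> n)"
    and sub: "(\<Inter>n. \<U> n) \<subseteq> A" "A \<subseteq> {g. g holomorphic_on UNIV}"
  shows "comeager_in (holo_space UNIV) A"
  unfolding comeager_in_def
proof (intro conjI exI[of _ "\<Inter>n. \<U> n"])
  show "A \<subseteq> topspace (holo_space UNIV)" using sub(2) by (simp add: topspace_holo_space holo_functions_UNIV)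
  show "gdelta_in (holo_space UNIV) (\<Inter>n. \<U> n)"
    using op by (intro gdelta_in_Inter) (auto intro: open_imp_gdelta_in)
  show "dense_in (holo_space UNIV) (\<Inter>n. \<U> n)"
    using sub Baire_entire[OF op dn] by (intro dense_entire_imp_dense_in) auto
qed (rule sub(1))

section \<open>Universal entire functions\<close>

definition orbit_approximants ::
  "(complex \<Rightarrow> complex) \<Rightarrow> complex set \<Rightarrow> complex poly \<Rightarrow> real \<Rightarrow> (complex \<Rightarrow> complex) set" where
  "orbit_approximants f K q e =
     {g. g holomorphic_on UNIV \<and> (\<exists>n\<ge>1. \<forall>z\<in>K. cmod (g ((f ^^ n) z) - poly q z) < e)}"

text \<open>
  The strict inequality on the compact set \<open>K\<close> leaves a margin, by which \<open>g\<close> may be changed on the compact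
  set \<open>f\<^sup>n(K)\<close>.
\<close>

lemma openin_orbit_approximants:
  assumes f: "f holomorphic_on UNIV" and K: "compact K"
  shows "openin (holo_space UNIV) (orbit_approximants f K q e)"
  unfolding openin_holo_space holo_functions_UNIV
proof (intro conjI ballI)
  show "orbit_approximants f K q e \<subseteq> {g. g holomorphic_on UNIV}" by (auto simp: orbit_approximants_def)
  fix g assume "g \<in> orbit_approximants f K q e"
  then obtain n where g: "g holomorphic_on UNIV" and n: "n \<ge> 1" "\<forall>z\<in>K. cmod (g ((f ^^ n) z) - poly q z) < e"
    by (auto simp: orbit_approximants_def)
  have cf: "continuous_on K (f ^^ n)"
    using holomorphic_on_imp_continuous_on[OF holomorphic_on_funpow[OF f]] continuous_on_subset by blast
  have cg: "continuous_on UNIV g" using g holomorphic_on_imp_continuous_on by blast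
  have c: "continuous_on K (\<lambda>z. cmod (g ((f ^^ n) z) - poly q z))"
    by (intro continuous_intros continuous_on_compose2[OF cg cf]) auto
  obtain d where d: "d > 0" "\<forall>z\<in>K. cmod (g ((f ^^ n) z) - poly q z) + d \<le> e"
  proof (cases "K = {}")
    case True then show ?thesis using that[of 1] by simp
  next
    case False
    then obtain w where w: "w \<in> K" "\<forall>z\<in>K. cmod (g ((f ^^ n) z) - poly q z) \<le> cmod (g ((f ^^ n) w) - poly q w)"
      using continuous_attains_sup[OF K _ c] by blast
    show ?thesis
      by (rule that[of "e - cmod (g ((f ^^ n) w) - poly q w)"]) (use w n in auto)
  qed
  show "\<exists>L \<delta>. compact L \<and> L \<subseteq> UNIV \<and> \<delta> > 0 \<and>
      {h \<in> {g. g holomorphic_on UNIV}. \<forall>z\<in>L. dist (h z) (g z) < \<delta>} \<subseteq> orbit_approximants f K q e"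
  proof (intro exI conjI subsetI)
    show "compact ((f ^^ n) ` K)" using cf K by (rule compact_continuous_image)
    show "d > 0" by (rule d)
    fix h assume h: "h \<in> {h \<in> {g. g holomorphic_on UNIV}. \<forall>z\<in>(f ^^ n) ` K. dist (h z) (g z) < d}"
    have "cmod (h ((f ^^ n) z) - poly q z) < e" if z: "z \<in> K" for z
    proof -
      have "cmod (h ((f ^^ n) z) - g ((f ^^ n) z)) < d" using h z by (auto simp: dist_norm)
      moreover have "cmod (g ((f ^^ n) z) - poly q z) + d \<le> e" using d(2) z by blast
      ultimately show ?thesis
        using norm_triangle_ineq[of "h ((f ^^ n) z) - g ((f ^^ n) z)" "g ((f ^^ n) z) - poly q z"] by simp
    qed
    then show "h \<in> orbit_approximants f K q e" using h n(1) by (auto simp: orbit_approximants_def)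
  qed auto
qed

text \<open>
  Runge's theorem on the union of a disc with the distant set \<open>f\<^sup>n(K)\<close>, for the function that is
  \<open>g0\<close> near the disc and \<open>q \<circ> f\<^sup>-\<^sup>n\<close> near \<open>f\<^sup>n(K)\<close>.
\<close>

lemma dense_orbit_approximants:
  assumes f: "f holomorphic_on UNIV" and \<Omega>: "open \<Omega>" and inj: "\<And>n. inj_on (f ^^ n) \<Omega>"
    and esc: "escapes f \<Omega>" and K: "compact K" "connected (- K)" "K \<subseteq> \<Omega>" and e: "e > 0"
  shows "dense_entire (orbit_approximants f K q e)"
  unfolding dense_entire_def
proof (intro allI impI)
  fix g0 :: "complex \<Rightarrow> complex" and r d :: real
  assume g0: "g0 holomorphic_on UNIV" and d: "d > 0"
  have "\<forall>\<^sub>F n in sequentially. (\<forall>z\<in>K. r + 1 < cmod ((f ^^ n) z)) \<and> 1 \<le> n"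
    using escapesD[OF esc K(1,3)] eventually_ge_at_top by (rule eventually_conj)
  then obtain n where n: "\<forall>z\<in>K. r + 1 < cmod ((f ^^ n) z)" "1 \<le> n"
    unfolding eventually_sequentially by blast
  define F where "F = f ^^ n"
  have holF: "F holomorphic_on A" for A
    using holomorphic_on_funpow[OF f] holomorphic_on_subset unfolding F_def by blast
  have contF: "continuous_on A F" for A using holF holomorphic_on_imp_continuous_on by blast
  \<comment> \<open>Restricting to points with large image makes the two pieces of the domain of \<open>\<phi>\<close> disjoint.\<close>
  define \<Omega>' where "\<Omega>' = \<Omega> \<inter> F -` (- cball 0 (r + 1))"
  have op': "open \<Omega>'" unfolding \<Omega>'_def using contF \<Omega> by (intro continuous_open_preimage) auto
  have inj': "inj_on F \<Omega>'" using inj[of n] by (auto simp: F_def \<Omega>'_def intro: inj_on_subset)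
  have K': "K \<subseteq> \<Omega>'" using K(3) n(1) by (auto simp: \<Omega>'_def F_def)
  obtain G where G: "G holomorphic_on (F ` \<Omega>')" "\<And>z. z \<in> \<Omega>' \<Longrightarrow> G (F z) = z"
    using holomorphic_has_inverse[OF holF op' inj'] by metis
  have opF: "open (F ` \<Omega>')" using open_mapping_thm3[OF holF op' inj'] .
  define \<phi> where "\<phi> w = (if w \<in> ball 0 (r + 1) then g0 w else poly q (G w))" for w
  have disj: "ball 0 (r + 1) \<inter> F ` \<Omega>' = {}" by (auto simp: \<Omega>'_def)
  have "\<phi> holomorphic_on (ball 0 (r + 1) \<union> F ` \<Omega>')"
  proof (rule holomorphic_on_Un)
    show "\<phi> holomorphic_on ball 0 (r + 1)"
      using holomorphic_on_subset[OF g0, of "ball 0 (r + 1)"] by (rule holomorphic_transform) (auto simp: \<phi>_def)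
    have "(\<lambda>w. poly q (G w)) holomorphic_on F ` \<Omega>'" by (intro holomorphic_intros G(1))
    then show "\<phi> holomorphic_on F ` \<Omega>'"
      by (rule holomorphic_transform) (use disj in \<open>auto simp: \<phi>_def\<close>)
  qed (use opF in auto)
  moreover have "connected (- (cball 0 r \<union> F ` K))"
  proof (rule Janiszewski_connected)
    have "F ` K \<subseteq> F ` \<Omega>'" using K' by blast
    then have "cball 0 r \<inter> F ` K = {}" using disj by (force simp: disjoint_iff)
    then show "connected (cball 0 r \<inter> F ` K)" by simp
    show "connected (- cball (0::complex) r)"
    proof (cases "r \<ge> 0")
      case True
      then show ?thesis by (intro connected_complement_bounded_convex) auto
    next
      case False
      then show ?thesis by (simp add: connected_UNIV)
    qed
    show "closed (F ` K)" using K(1) contF by (intro compact_imp_closed compact_continuous_image)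
    show "connected (- (F ` K))"
      using K inj' K' by (intro nonseparating_inj_image contF) (auto intro: inj_on_subset)
  qed auto
  moreover have "compact (cball 0 r \<union> F ` K)"
    using K(1) contF by (intro compact_Un compact_continuous_image) auto
  moreover have "cball 0 r \<union> F ` K \<subseteq> ball 0 (r + 1) \<union> F ` \<Omega>'" using K' by auto
  ultimately have "poly_approximable (cball 0 r \<union> F ` K) \<phi>"
    using opF by (intro Runge_polynomial[of _ "ball 0 (r + 1) \<union> F ` \<Omega>'"]) auto
  then obtain p where p: "\<And>z. z \<in> cball 0 r \<union> F ` K \<Longrightarrow> cmod (\<phi> z - poly p z) < min d e"
    using poly_approximableD[of _ \<phi> "min d e"] d e by (metis min_less_iff_conj)
  show "\<exists>h\<in>orbit_approximants f K q e. \<forall>z. cmod z \<le> r \<longrightarrow> cmod (h z - g0 z) < d"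
  proof (intro bexI[of _ "poly p"] allI impI)
    fix z :: complex assume "cmod z \<le> r"
    then show "cmod (poly p z - g0 z) < d"
      using p[of z] by (simp add: \<phi>_def norm_minus_commute)
  next
    have "cmod (poly p ((f ^^ n) z) - poly q z) < e" if z: "z \<in> K" for z
    proof -
      have "z \<in> \<Omega>'" using z K' by blast
      then have "F z \<notin> ball 0 (r + 1)" "G (F z) = z" using disj G(2) by blast+
      then show ?thesis using p[of "F z"] z by (simp add: \<phi>_def norm_minus_commute F_def)
    qed
    moreover have "poly p holomorphic_on UNIV" by (intro holomorphic_intros)
    ultimately show "poly p \<in> orbit_approximants f K q e"
      using n(2) by (auto simp: orbit_approximants_def)
  qed
qed

definition poly_universal :: "(complex \<Rightarrow> complex) \<Rightarrow> complex set \<Rightarrow> (complex \<Rightarrow> complex) set" where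
  "poly_universal f \<Omega> = {g. g holomorphic_on UNIV \<and>
     (\<forall>K q e. compact K \<longrightarrow> connected (- K) \<longrightarrow> K \<subseteq> \<Omega> \<longrightarrow> e > 0 \<longrightarrow> g \<in> orbit_approximants f K q e)}"

text \<open>
  The quantifiers over compact sets, polynomials and errors reduce to countable ones: pass to a larger
  nonseparating set from a countable cofinal family, to a polynomial with rational coefficients,
  and to an error \<open>1/(k+1)\<close>.
\<close>

lemma comeager_poly_universal:
  assumes f: "f holomorphic_on UNIV" and \<Omega>: "open \<Omega>" and inj: "\<And>n. inj_on (f ^^ n) \<Omega>"
    and esc: "escapes f \<Omega>" and A: "poly_universal f \<Omega> \<subseteq> A" "A \<subseteq> {g. g holomorphic_on UNIV}"
  shows "comeager_in (holo_space UNIV) A"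
proof -
  obtain \<K> where \<K>1: "countable \<K>" and \<K>2: "\<forall>L\<in>\<K>. compact L \<and> connected (- L) \<and> L \<subseteq> \<Omega>"
    and \<K>3: "\<forall>K. compact K \<longrightarrow> connected (- K) \<longrightarrow> K \<subseteq> \<Omega> \<longrightarrow> (\<exists>L\<in>\<K>. K \<subseteq> L)"
    by (rule countable_cofinal_nonseparating[OF \<Omega>])
  note \<K> = \<K>1 \<K>2[rule_format] \<K>3[rule_format]
  define I where "I = \<K> \<times> (UNIV :: ((rat \<times> rat) list \<times> nat) set)"
  have I: "countable I" unfolding I_def using \<K>(1) by auto
  have "I \<noteq> {}" using \<K>(3)[of "{}"] by (auto simp: I_def connected_UNIV)
  define S where "S = (\<lambda>(L, xs, k). orbit_approximants f L (rational_poly xs) (1 / real (Suc k)))"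
  have op: "openin (holo_space UNIV) (S i)" "dense_entire (S i)" if "i \<in> I" for i
    using that \<K>(2) by (auto simp: I_def S_def intro!: openin_orbit_approximants dense_orbit_approximants f \<Omega> inj esc)
  define \<U> where "\<U> n = S (from_nat_into I n)" for n
  have inI: "from_nat_into I n \<in> I" for n using \<open>I \<noteq> {}\<close> by (rule from_nat_into)
  have "(\<Inter>n. \<U> n) \<subseteq> poly_universal f \<Omega>"
  proof
    fix g assume g: "g \<in> (\<Inter>n. \<U> n)"
    have gS: "g \<in> S i" if i: "i \<in> I" for i
    proof -
      obtain n where "i = from_nat_into I n" using from_nat_into_surj[OF I i] by metis
      then show ?thesis using g by (auto simp: \<U>_def)
    qed
    have hol: "g holomorphic_on UNIV"
      using gS[OF inI[of 0]] by (auto simp: S_def orbit_approximants_def split: prod.splits)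
    have "g \<in> orbit_approximants f K q e" if K: "compact K" "connected (- K)" "K \<subseteq> \<Omega>" and e: "e > 0" for K q e
    proof -
      obtain L where L: "L \<in> \<K>" "K \<subseteq> L" using \<K>(3)[OF K] by blast
      have e2: "e / 2 > 0" using e by simp
      obtain k where k: "1 / real (Suc k) < e / 2" using nat_approx_posE[OF e2] by metis
      obtain xs where xs: "\<forall>z\<in>K. cmod (poly q z - poly (rational_poly xs) z) < e / 2"
        using rational_poly_approx[OF K(1) e2] by blast
      have "g \<in> S (L, xs, k)" using gS L(1) by (auto simp: I_def)
      then obtain n where n: "n \<ge> 1" "\<forall>z\<in>L. cmod (g ((f ^^ n) z) - poly (rational_poly xs) z) < 1 / real (Suc k)"
        unfolding S_def orbit_approximants_def by auto
      have "cmod (g ((f ^^ n) z) - poly q z) < e" if z: "z \<in> K" for z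
      proof -
        have "cmod (g ((f ^^ n) z) - poly (rational_poly xs) z) < 1 / real (Suc k)" using n(2) L(2) z by blast
        moreover have "cmod (poly (rational_poly xs) z - poly q z) < e / 2" using xs z by (simp add: norm_minus_commute)
        ultimately show ?thesis
          using k norm_triangle_ineq[of "g ((f ^^ n) z) - poly (rational_poly xs) z" "poly (rational_poly xs) z - poly q z"]
          by simp
      qed
      then show ?thesis using hol n(1) by (auto simp: orbit_approximants_def)
    qed
    then show "g \<in> poly_universal f \<Omega>" using hol by (simp add: poly_universal_def)
  qed
  then show ?thesis
    using A inI by (intro comeager_Inter_entire[of \<U>]) (auto simp: \<U>_def intro: op)
qed

text \<open>
  Runge's theorem replaces a function holomorphic on \<open>W\<close> by a polynomial on a nonseparating set \<open>L\<close>,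
  where \<open>g\<close> is known to approximate it.
\<close>

lemma poly_universal_imp_universal_for:
  assumes f: "f holomorphic_on UNIV" and g: "g \<in> poly_universal f \<Omega>" and W: "open W" "W \<subseteq> \<Omega>"
    and fill: "\<And>K. compact K \<Longrightarrow> K \<subseteq> W \<Longrightarrow> \<exists>L. compact L \<and> connected (- L) \<and> K \<subseteq> L \<and> L \<subseteq> W"
  shows "universal_for f W g"
  unfolding universal_for_def dense_in_def
proof (intro conjI)
  show hol: "g holomorphic_on UNIV" using g by (simp add: poly_universal_def)
  define D where "D = {restrict (g \<circ> (f ^^ n)) W |n. n \<ge> 1}"
  have inH: "restrict (g \<circ> (f ^^ n)) W \<in> holo_functions W" for n
  proof -
    have "(g \<circ> (f ^^ n)) holomorphic_on W"
      using holomorphic_on_compose_gen[OF holomorphic_on_funpow[OF f] hol] holomorphic_on_subset by blast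
    then have "restrict (g \<circ> (f ^^ n)) W holomorphic_on W" by (rule holomorphic_transform) auto
    then show ?thesis by (simp add: holo_functions_def)
  qed
  then show "D \<subseteq> topspace (holo_space W)" by (auto simp: D_def topspace_holo_space)
  show "holo_space W closure_of D = topspace (holo_space W)"
  proof (intro equalityI closure_of_subset_topspace subsetI)
    fix h assume h: "h \<in> topspace (holo_space W)"
    then have hh: "h holomorphic_on W" by (simp add: topspace_holo_space holo_functions_def)
    show "h \<in> holo_space W closure_of D"
      unfolding in_closure_of
    proof (intro conjI h allI impI)
      fix T assume T: "h \<in> T \<and> openin (holo_space W) T"
      then obtain K e where K: "compact K" "K \<subseteq> W" "e > 0"
          "{k \<in> holo_functions W. \<forall>z\<in>K. dist (k z) (h z) < e} \<subseteq> T"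
        unfolding openin_holo_space by blast
      obtain L where L: "compact L" "connected (- L)" "K \<subseteq> L" "L \<subseteq> W" using fill[OF K(1,2)] by blast
      have e2: "e / 2 > 0" using K(3) by simp
      have P: "poly_approximable L h" by (rule Runge_polynomial[OF L(1,2) W(1) L(4) hh])
      obtain q where q: "\<And>z. z \<in> L \<Longrightarrow> cmod (h z - poly q z) < e / 2" by (rule poly_approximableD[OF P e2]) (rule that; blast)
      have "g \<in> orbit_approximants f L q (e / 2)" using g L W(2) e2 by (simp add: poly_universal_def)
      then obtain n where n: "n \<ge> 1" "\<forall>z\<in>L. cmod (g ((f ^^ n) z) - poly q z) < e / 2"
        by (auto simp: orbit_approximants_def)
      have "restrict (g \<circ> (f ^^ n)) W \<in> T"
      proof (rule subsetD[OF K(4)], intro CollectI conjI inH ballI)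
        fix z assume z: "z \<in> K"
        then have "cmod (g ((f ^^ n) z) - poly q z) < e / 2" "cmod (poly q z - h z) < e / 2"
          using n(2) q[of z] L(3) by (auto simp: norm_minus_commute)
        then have "cmod (g ((f ^^ n) z) - h z) < e"
          using norm_triangle_ineq[of "g ((f ^^ n) z) - poly q z" "poly q z - h z"] by simp
        then show "dist (restrict (g \<circ> (f ^^ n)) W z) (h z) < e" using z K(2) by (auto simp: dist_norm)
      qed
      moreover have "restrict (g \<circ> (f ^^ n)) W \<in> D" using n(1) by (auto simp: D_def)
      ultimately show "\<exists>y. y \<in> D \<and> y \<in> T" by blast
    qed
  qed
qed

lemma nonseparating_superset:
  fixes K W :: "complex set"
  assumes "compact K" "K \<subseteq> W" "inside K \<subseteq> W"
  shows "\<exists>L. compact L \<and> connected (- L) \<and> K \<subseteq> L \<and> L \<subseteq> W"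
  using assms compact_Un_inside connected_Compl_Un_inside by (intro exI[of _ "K \<union> inside K"]) auto

lemma simply_connected_holomorphic_image:
  assumes f: "f holomorphic_on G" and G: "open G" "inj_on f G" "simply_connected G"
  shows "simply_connected (f ` G)"
proof -
  obtain g where g: "g holomorphic_on (f ` G)" "\<And>z. z \<in> G \<Longrightarrow> g (f z) = z"
    using holomorphic_has_inverse[OF f G(1,2)] by metis
  have "G homeomorphic f ` G"
    using f g by (intro homeomorphicI[of f _ _ g]) (force intro: holomorphic_on_imp_continuous_on)+
  then show ?thesis using G(3) homeomorphic_simply_connected_eq by blast
qed

lemma comeager_universal_Baker_domain:
  assumes f: "transcendental_entire f" and G: "invariant_baker_domain f G" and inj: "inj_on f G"
  shows "comeager_in (holo_space UNIV) {g. universal_for f G g}"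
proof -
  have hol: "f holomorphic_on UNIV" using f by (simp add: transcendental_entire_def)
  have Gc: "fatou_component f G" "f ` G \<subseteq> G" and esc: "escapes f G"
    using G by (auto simp: invariant_baker_domain_def tends_to_infinity_on_iff_escapes)
  have op: "open G" using Gc(1) open_components[OF open_fatou_set] by (simp add: fatou_component_def)
  have injn: "inj_on (f ^^ n) G \<and> (f ^^ n) ` G \<subseteq> G" for n
  proof (induction n)
    case (Suc n)
    then have "inj_on f ((f ^^ n) ` G)" using inj inj_on_subset by blast
    then have "inj_on (f ^^ Suc n) G" using Suc comp_inj_on[of "f ^^ n" G f] by (simp add: o_def)
    moreover have "(f ^^ Suc n) ` G \<subseteq> G" using Suc Gc(2) by auto
    ultimately show ?case by blast
  qed simp
  show ?thesis
  proof (rule comeager_poly_universal[OF hol op _ esc])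
    show "poly_universal f G \<subseteq> {g. universal_for f G g}"
      using nonseparating_superset invariant_escaping_component_fills[OF f Gc esc] op
      by (auto intro!: poly_universal_imp_universal_for[OF hol])
    show "{g. universal_for f G g} \<subseteq> {g. g holomorphic_on UNIV}" by (auto simp: universal_for_def)
  qed (use injn in blast)
qed

text \<open>
  The forward orbit is a disjoint union of copies of \<open>G\<close>.  Different pieces keep having disjoint images,
  so injectivity of the iterates passes to the union; and a compact set has compact parts in finitely
  many pieces, which can be treated separately.
\<close>

lemma forward_orbit_wandering:
  assumes f: "f holomorphic_on UNIV" and G: "wandering_domain f G"
    and inj: "\<And>n. inj_on (f ^^ n) G" and esc: "escapes f G"
  shows "open (forward_orbit f G)" "\<And>n. inj_on (f ^^ n) (forward_orbit f G)" "escapes f (forward_orbit f G)"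
    "simply_connected G \<Longrightarrow> compact K \<Longrightarrow> K \<subseteq> forward_orbit f G \<Longrightarrow>
       \<exists>L. compact L \<and> connected (- L) \<and> K \<subseteq> L \<and> L \<subseteq> forward_orbit f G"
proof -
  define U where "U k = (f ^^ k) ` G" for k
  have Gc: "G \<in> components (fatou_set f)" using G by (simp add: wandering_domain_def fatou_component_def)
  have opG: "open G" using open_components[OF open_fatou_set Gc] .
  have holn: "(f ^^ k) holomorphic_on G" for k using holomorphic_on_funpow[OF f] holomorphic_on_subset by blast
  have opU: "open (U k)" for k unfolding U_def using open_mapping_thm3[OF holn opG inj] .
  have disj: "U i \<inter> U j = {}" if "i \<noteq> j" for i j
    unfolding U_def using wandering_images_disjoint[OF f G inj esc that] .
  have FU: "forward_orbit f G = (\<Union>k\<in>{1..}. U k)" by (simp add: forward_orbit_def U_def)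
  show "open (forward_orbit f G)" unfolding FU using opU by blast
  show "inj_on (f ^^ n) (forward_orbit f G)" for n
  proof (rule inj_onI)
    fix x y assume xy: "x \<in> forward_orbit f G" "y \<in> forward_orbit f G" "(f ^^ n) x = (f ^^ n) y"
    obtain i a where a: "a \<in> G" "x = (f ^^ i) a" using xy(1) by (auto simp: forward_orbit_def)
    obtain j b where b: "b \<in> G" "y = (f ^^ j) b" using xy(2) by (auto simp: forward_orbit_def)
    have eq: "(f ^^ (n + i)) a = (f ^^ (n + j)) b" using xy(3) a b by (simp add: funpow_add)
    have "(f ^^ (n + i)) a \<in> U (n + i)" "(f ^^ (n + j)) b \<in> U (n + j)"
      unfolding U_def using a(1) b(1) by blast+
    then have ij: "i = j" using eq disj[of "n + i" "n + j"] by auto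
    then have "a = b" using inj_onD[OF inj eq[folded ij]] a b by simp
    then show "x = y" using a b ij by simp
  qed
  have decomp: "\<exists>F. finite F \<and> F \<subseteq> {1..} \<and> L = (\<Union>i\<in>F. L \<inter> U i) \<and> (\<forall>i\<in>F. compact (L \<inter> U i))"
    if "compact L" "L \<subseteq> forward_orbit f G" for L
    using compact_in_disjoint_Union[of L U "{1..}"] that opU disj unfolding FU by metis
  show "escapes f (forward_orbit f G)"
    unfolding escapes_def
  proof (intro allI impI)
    fix L and R :: real assume "compact L" "L \<subseteq> forward_orbit f G"
    from decomp[OF this] obtain F where F: "finite F" "L = (\<Union>i\<in>F. L \<inter> U i)" "\<forall>i\<in>F. compact (L \<inter> U i)" by blast
    have "\<forall>\<^sub>F n in sequentially. \<forall>z\<in>L \<inter> U i. R < cmod ((f ^^ n) z)" if "i \<in> F" for i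
    proof (rule escapesD)
      show "escapes f (U i)" unfolding U_def by (rule escapes_image[OF f opG inj esc])
      show "compact (L \<inter> U i)" using F(3) that by blast
    qed simp
    then have "\<forall>\<^sub>F n in sequentially. \<forall>i\<in>F. \<forall>z\<in>L \<inter> U i. R < cmod ((f ^^ n) z)"
      using F(1) by (simp add: eventually_ball_finite)
    then show "\<forall>\<^sub>F n in sequentially. \<forall>z\<in>L. R < cmod ((f ^^ n) z)"
    proof eventually_elim
      case (elim n)
      then show ?case using F(2) by blast
    qed
  qed
  assume sc: "simply_connected G" and K: "compact K" "K \<subseteq> forward_orbit f G"
  from decomp[OF K] obtain F where F: "finite F" "F \<subseteq> {1..}" "K = (\<Union>i\<in>F. K \<inter> U i)" "\<forall>i\<in>F. compact (K \<inter> U i)" by blast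
  define N where "N i = (K \<inter> U i) \<union> inside (K \<inter> U i)" for i
  have NU: "N i \<subseteq> U i" for i
  proof -
    have "simply_connected (U i)"
      unfolding U_def by (rule simply_connected_holomorphic_image[OF holn opG inj sc])
    then show ?thesis
      unfolding N_def using subset_simply_connected_imp_inside_subset[OF _ opU, of i "K \<inter> U i"] by simp
  qed
  have cN: "compact (N i)" "connected (- N i)" if "i \<in> F" for i
    using F(4) that unfolding N_def by (auto intro: compact_Un_inside connected_Compl_Un_inside simp del: compl_sup)
  show "\<exists>L. compact L \<and> connected (- L) \<and> K \<subseteq> L \<and> L \<subseteq> forward_orbit f G"
  proof (intro exI conjI)
    show "compact (\<Union>i\<in>F. N i)" using F(1) cN by (intro compact_UN) auto
    show "connected (- (\<Union>i\<in>F. N i))"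
    proof (rule nonseparating_disjoint_Union[OF F(1) cN])
      fix i j :: nat assume "i \<noteq> j"
      then show "N i \<inter> N j = {}" using NU[of i] NU[of j] disj[of i j] by blast
    qed
    show "K \<subseteq> (\<Union>i\<in>F. N i)" using F(3) by (auto simp: N_def)
    show "(\<Union>i\<in>F. N i) \<subseteq> forward_orbit f G" unfolding FU using NU F(2) by blast
  qed
qed

theorem theorem4p11:
  fixes f :: "complex \<Rightarrow> complex"
  assumes "transcendental_entire f"
  shows
    "(\<forall>G. invariant_baker_domain f G \<and> inj_on f G \<longrightarrow>
        comeager_in (holo_space UNIV) {g. universal_for f G g})
   \<and> (\<forall>G. wandering_domain f G \<and> (\<forall>n\<ge>1. inj_on (f ^^ n) G) \<and> tends_to_infinity_on f G \<longrightarrow>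
        comeager_in (holo_space UNIV)
          {g. g holomorphic_on UNIV \<and>
              (\<forall>W \<in> open_subsets_without_holes (forward_orbit f G). universal_for f W g)}
      \<and> (simply_connected G \<longrightarrow>
          comeager_in (holo_space UNIV) {g. universal_for f (forward_orbit f G) g}))"
proof (intro conjI allI impI)
  fix G assume "invariant_baker_domain f G \<and> inj_on f G"
  then show "comeager_in (holo_space UNIV) {g. universal_for f G g}"
    using comeager_universal_Baker_domain[OF assms] by blast
next
  fix G
  have hol: "f holomorphic_on UNIV" using assms by (simp add: transcendental_entire_def)
  let ?\<Omega> = "forward_orbit f G"
  assume "wandering_domain f G \<and> (\<forall>n\<ge>1. inj_on (f ^^ n) G) \<and> tends_to_infinity_on f G"
  then have G: "wandering_domain f G" "\<And>n. n \<ge> 1 \<Longrightarrow> inj_on (f ^^ n) G" "escapes f G"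
    by (auto simp: tends_to_infinity_on_iff_escapes)
  have inj: "inj_on (f ^^ n) G" for n using G(2)[of n] by (cases "n = 0") auto
  note orbit = forward_orbit_wandering[OF hol G(1) inj G(3)]
  note comeager = comeager_poly_universal[OF hol orbit(1-3)]
  show "comeager_in (holo_space UNIV)
      {g. g holomorphic_on UNIV \<and> (\<forall>W \<in> open_subsets_without_holes ?\<Omega>. universal_for f W g)}"
  proof (rule comeager)
    show "poly_universal f ?\<Omega> \<subseteq>
        {g. g holomorphic_on UNIV \<and> (\<forall>W \<in> open_subsets_without_holes ?\<Omega>. universal_for f W g)}"
    proof (intro subsetI CollectI conjI ballI)
      fix g W assume g: "g \<in> poly_universal f ?\<Omega>" and "W \<in> open_subsets_without_holes ?\<Omega>"
      then have W: "open W" "W \<subseteq> ?\<Omega>" "holes W = {}" by (auto simp: open_subsets_without_holes_def)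
      show "universal_for f W g"
        by (rule poly_universal_imp_universal_for[OF hol g W(1,2)])
          (use nonseparating_superset inside_subset_without_holes[OF W(3)] in blast)
    qed (simp add: poly_universal_def)
  qed auto
  assume sc: "simply_connected G"
  show "comeager_in (holo_space UNIV) {g. universal_for f ?\<Omega> g}"
  proof (rule comeager)
    show "poly_universal f ?\<Omega> \<subseteq> {g. universal_for f ?\<Omega> g}"
      using orbit(1) orbit(4)[OF sc] by (auto intro!: poly_universal_imp_universal_for[OF hol])
  qed (auto simp: universal_for_def)
qed

end
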